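(* Let $f,g:[0,\infty)\times\mathbb R^{d-1}\to\mathbb R$ be classical solutions of the $d$-dimensional Muskat equation $$\partial_t f(t,x)=\mathrm{P.V.}\int_{\mathbb R^{d-1}}\frac{f(t,y)-f(t,x)-\nabla_xf(t,x)\cdot(y-x)}{\big((f(t,y)-f(t,x))^2+|y-x|^2\big)^{d/2}}\,dy$$ with $\|\nabla_xf\|_{L^\infty},\|\nabla_xg\|_{L^\infty}<\frac1{\sqrt{2d-1}}$ (suprema over all times and points), and suppose $f(0,x)\le g(0,x)$ for all $x\in\mathbb R^{d-1}$. Then $f(t,x)\le g(t,x)$ for all $t\ge0$ and $x\in\mathbb R^{d-1}$.
   Context: Classical solution: $f:[0,T]\times\mathbb R^{d-1}\to\mathbb R$ is a classical solution of the $d$-dimensional Muskat equation if (1) $f\in C^1((0,T)\times\mathbb R^{d-1})$ and $\|f(\epsilon,\cdot)-f(0,\cdot)\|_{L^\infty}\to0$, $\|f(T,\cdot)-f(T-\epsilon,\cdot)\|_{L^\infty}\to 0$ as $\epsilon\to0+$; (2) for every compact $\mathcal K\subseteq(0,T)\times\mathbb R^{d-1}$ there are smooth nonnegative functions $\omega,\Omega:[0,\infty)\to[0,\infty)$ with $\sup_{(t,x)\in\mathcal K}\sup_{h\in B_r}|f(t,x+h)-f(t,x)-\nabla_xf(t,x)\cdot h|\le\omega(r)r$, $\sup_{(t,x)\in\mathcal K}\sup_{h\in B_R}|f(t,x+h)-f(t,x)|\le\Omega(R)$ and $\int_0^1\frac{\omega(r)}{r}dr+\int_1^\infty\frac{\Omega(R)}{R^2}dR<\infty$;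 (3) the equation holds at every $(t,x)\in(0,T)\times\mathbb R^{d-1}$, the integral being taken in the principal value sense around $y=x$ and $\infty$. A function on $[0,\infty)\times\mathbb R^{d-1}$ is a classical solution if its restriction to $[0,T]\times\mathbb R^{d-1}$ is one for every $T>0$. Here $d\ge2$ is an integer. *)

theory Defs
  imports "HOL-Probability.Essential_Supremum"
begin

text \<open>Functions \<open>f(t,x)\<close> are rendered as \<open>f :: real \<Rightarrow> real ^ 'n \<Rightarrow> real\<close>, where the type \<open>'n\<close>
  has \<open>d - 1\<close> elements, so that the exponent \<open>d\<close> of the Muskat equation is \<open>CARD('n) + 1\<close>.\<close>

definition grad :: "('a::euclidean_space \<Rightarrow> real) \<Rightarrow> 'a \<Rightarrow> 'a" where
  "grad u x = (THE D. GDERIV u x :> D)"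

definition Linf_norm :: "('a::euclidean_space \<Rightarrow> real) \<Rightarrow> ereal" where
  "Linf_norm u = esssup lebesgue (\<lambda>x. ereal \<bar>u x\<bar>)"

definition C1_on :: "'a::real_normed_vector set \<Rightarrow> ('a \<Rightarrow> real) \<Rightarrow> bool" where
  "C1_on S u \<longleftrightarrow>
     (\<exists>u' :: 'a \<Rightarrow> 'a \<Rightarrow>\<^sub>L real.
        (\<forall>p\<in>S. (u has_derivative blinfun_apply (u' p)) (at p)) \<and> continuous_on S u')"

text \<open>\<open>C\<^sup>\<infinity>\<close> on \<open>[0,\<infinity>)\<close>, with one-sided derivatives of all orders at \<open>0\<close>; \<open>D k\<close> is the
  \<open>k\<close>-th derivative.\<close>

definition smooth_halfline :: "(real \<Rightarrow> real) \<Rightarrow> bool" where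
  "smooth_halfline w \<longleftrightarrow>
     (\<exists>D :: nat \<Rightarrow> real \<Rightarrow> real.
        (\<forall>r\<ge>0. D 0 r = w r) \<and>
        (\<forall>k. \<forall>r\<ge>0. (D k has_real_derivative D (Suc k) r) (at r within {0..})))"

text \<open>Principal value around \<open>y = x\<close> and \<open>\<infinity>\<close>: the inner radius \<open>\<epsilon> \<rightarrow> 0+\<close> and the outer radius
  \<open>R \<rightarrow> \<infinity>\<close> vary independently.\<close>

definition has_pv_integral :: "('a::euclidean_space \<Rightarrow> real) \<Rightarrow> real \<Rightarrow> 'a \<Rightarrow> bool" where
  "has_pv_integral \<phi> I x \<longleftrightarrow>
     (\<forall>\<epsilon> R. 0 < \<epsilon> \<longrightarrow> \<epsilon> < R \<longrightarrow>
        set_integrable lborel {y. \<epsilon> < dist x y \<and> dist x y < R} \<phi>) \<and>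
     ((\<lambda>(\<epsilon>, R). LINT y:{y. \<epsilon> < dist x y \<and> dist x y < R}|lborel. \<phi> y) \<longlongrightarrow> I)
        (at_right 0 \<times>\<^sub>F at_top)"

definition muskat_integrand :: "(real ^ 'n \<Rightarrow> real) \<Rightarrow> real ^ 'n \<Rightarrow> real ^ 'n \<Rightarrow> real" where
  "muskat_integrand u x y =
     (u y - u x - grad u x \<bullet> (y - x)) /
     ((u y - u x)\<^sup>2 + (norm (y - x))\<^sup>2) powr ((real CARD('n) + 1) / 2)"

definition muskat_moduli ::
  "(real \<Rightarrow> 'a::euclidean_space \<Rightarrow> real) \<Rightarrow> (real \<times> 'a) set \<Rightarrow> bool" where
  "muskat_moduli f K \<longleftrightarrow>
     (\<exists>\<omega> \<Omega> :: real \<Rightarrow> real.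
        smooth_halfline \<omega> \<and> smooth_halfline \<Omega> \<and>
        (\<forall>r\<ge>0. 0 \<le> \<omega> r \<and> 0 \<le> \<Omega> r) \<and>
        (\<forall>(t, x)\<in>K. \<forall>r\<ge>0. \<forall>h\<in>ball 0 r.
           \<bar>f t (x + h) - f t x - grad (f t) x \<bullet> h\<bar> \<le> \<omega> r * r) \<and>
        (\<forall>(t, x)\<in>K. \<forall>R\<ge>0. \<forall>h\<in>ball 0 R. \<bar>f t (x + h) - f t x\<bar> \<le> \<Omega> R) \<and>
        (\<integral>\<^sup>+r\<in>{0..1}. ennreal (\<omega> r / r) \<partial>lborel) +
        (\<integral>\<^sup>+R\<in>{1..}. ennreal (\<Omega> R / R\<^sup>2) \<partial>lborel) < \<infinity>)"

text \<open>Only the values \<open>f t\<close> for \<open>t \<in> {0..T}\<close> matter here.\<close>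

definition muskat_classical_solution_on ::
  "real \<Rightarrow> (real \<Rightarrow> real ^ 'n \<Rightarrow> real) \<Rightarrow> bool" where
  "muskat_classical_solution_on T f \<longleftrightarrow>
     C1_on ({0<..<T} \<times> UNIV) (\<lambda>(t, x). f t x) \<and>
     ((\<lambda>\<epsilon>. Linf_norm (\<lambda>x. f \<epsilon> x - f 0 x)) \<longlongrightarrow> 0) (at_right 0) \<and>
     ((\<lambda>\<epsilon>. Linf_norm (\<lambda>x. f T x - f (T - \<epsilon>) x)) \<longlongrightarrow> 0) (at_right 0) \<and>
     (\<forall>K. compact K \<and> K \<subseteq> {0<..<T} \<times> UNIV \<longrightarrow> muskat_moduli f K) \<and>
     (\<forall>t\<in>{0<..<T}. \<forall>x.
        has_pv_integral (muskat_integrand (f t) x) (deriv (\<lambda>s. f s x) t) x)"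

definition muskat_classical_solution :: "(real \<Rightarrow> real ^ 'n \<Rightarrow> real) \<Rightarrow> bool" where
  "muskat_classical_solution f \<longleftrightarrow> (\<forall>T>0. muskat_classical_solution_on T f)"

text \<open>The gradient exists only at positive times, so these are the times in the supremum; taking
  it in \<open>ereal\<close> gives \<open>\<infinity>\<close> for an unbounded gradient.\<close>

definition grad_sup_norm :: "(real \<Rightarrow> 'a::euclidean_space \<Rightarrow> real) \<Rightarrow> ereal" where
  "grad_sup_norm f = (SUP (t, x)\<in>{0<..} \<times> UNIV. ereal (norm (grad (f t) x)))"

end

theory Submission
  imports Defs
begin

text \<open>Since \<open>(2 d - 1) L\<^sup>2 < 1\<close>, the Muskat integrand is pointwise monotone in the height difference
  \<open>f(y) - f(x)\<close> as long as all slopes are at most \<open>L\<close>, so a first touching of \<open>f\<close> and \<open>g\<close> would be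
  impossible. Touching points need not exist on the unbounded space, and a penalty \<open>\<beta>\<langle>x\<rangle>\<close> that creates
  them also perturbs the gradients, at points where no uniform modulus of the gradients is available.
  Doubling the space variable cures this: at a maximum of
  \<open>f(t,x) - g(t,x+z) - |z|\<^sup>2/(2\<delta>) - \<beta>(t)\<langle>x\<rangle> - \<kappa>(t - t\<^sub>1)\<close>, where \<open>\<langle>x\<rangle> = sqrt (1 + |x|\<^sup>2)\<close>, the function \<open>f\<close>
  is touched from above and \<open>g\<close> from below by paraboloids of opening \<open>1/\<delta>\<close>. Up to a radius \<open>R\<close> of
  order \<open>\<langle>x\<rangle>\<close> the two nonlocal terms then differ by at most \<open>C\<^sub>\<delta> \<beta> R\<close>, and beyond \<open>R\<close> by a small amount, by the
  growth moduli and the oddness of the gradient term. Choosing \<open>\<beta>' = C\<^sub>\<delta> \<beta>\<close> absorbs the part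
  proportional to \<open>\<langle>x\<rangle>\<close>, and letting \<open>\<beta>\<close> be small contradicts the slope \<open>\<kappa>\<close> in time.\<close>

subsection \<open>Radial integrals\<close>

text \<open>Polar coordinates for radial functions: the half-lines \<open>{..a}\<close> generate the
  Borel sets, and their preimages under the norm are balls, whose volume \<open>?V * a ^ ?n\<close>
  is the integral of the stated density.\<close>

lemma distr_norm_lborel:
  "distr lborel borel (norm :: 'a::euclidean_space \<Rightarrow> real) =
   density lborel (\<lambda>r. ennreal (real DIM('a) * unit_ball_vol (real DIM('a)) * r ^ (DIM('a) - 1)) * indicator {0..} r)"
  (is "?M = ?N")
proof (rule measure_eqI_generator_eq[where E = "range atMost" and A = "\<lambda>i. {..real i}" and \<Omega> = UNIV])
  let ?n = "DIM('a)" and ?V = "unit_ball_vol (real DIM('a))"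
  have n: "?n > 0" by simp
  have lhs: "emeasure ?M {..a} = (if 0 \<le> a then ennreal (?V * a ^ ?n) else 0)" for a
  proof -
    have "emeasure ?M {..a} = emeasure lborel (cball (0::'a) a)"
      by (subst emeasure_distr) (auto intro!: arg_cong2[where f = emeasure])
    then show ?thesis by (auto simp: emeasure_cball)
  qed
  have rhs: "emeasure ?N {..a} = (if 0 \<le> a then ennreal (?V * a ^ ?n) else 0)" for a
  proof -
    have "emeasure ?N {..a} = (\<integral>\<^sup>+r. ennreal (real ?n * ?V * r ^ (?n - 1)) * indicator {0..a} r \<partial>lborel)"
      by (subst emeasure_density) (auto intro!: nn_integral_cong simp: indicator_def)
    also have "\<dots> = (if 0 \<le> a then ennreal (?V * a ^ ?n) else 0)"
    proof (cases "0 \<le> a")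
      case True
      have "(\<integral>\<^sup>+r. ennreal (real ?n * ?V * r ^ (?n - 1)) * indicator {0..a} r \<partial>lborel)
          = ennreal (?V * a ^ ?n - ?V * 0 ^ ?n)"
        using True by (intro nn_integral_FTC_Icc)
          (auto intro!: derivative_eq_intros)
      then show ?thesis using True n by simp
    qed simp
    finally show ?thesis .
  qed
  show "emeasure ?M X = emeasure ?N X" if "X \<in> range atMost" for X
    using that lhs rhs by auto
  show "emeasure ?M {..real i} \<noteq> \<infinity>" for i using lhs by simp
  show "Int_stable (range atMost :: real set set)"
    by (auto simp: Int_stable_def)
  show "sets ?M = sigma_sets UNIV (range atMost)" "sets ?N = sigma_sets UNIV (range atMost)"
    unfolding borel_eq_atMost by (simp_all add: borel_eq_atMost)
  show "(\<Union>i. {..real i}) = UNIV" using real_arch_simple by blast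
qed auto

lemma nn_integral_radial:
  fixes \<Phi> :: "real \<Rightarrow> ennreal"
  assumes [measurable]: "\<Phi> \<in> borel_measurable borel"
  shows "(\<integral>\<^sup>+x. \<Phi> (norm (x::'a::euclidean_space)) \<partial>lborel) =
    ennreal (real DIM('a) * unit_ball_vol (real DIM('a))) *
      (\<integral>\<^sup>+r\<in>{0<..}. ennreal (r ^ (DIM('a) - 1)) * \<Phi> r \<partial>lborel)"
proof -
  let ?c = "real DIM('a) * unit_ball_vol (real DIM('a))"
  have "(\<integral>\<^sup>+x. \<Phi> (norm (x::'a)) \<partial>lborel) = (\<integral>\<^sup>+r. \<Phi> r \<partial>distr lborel borel (norm :: 'a \<Rightarrow> real))"
    by (subst nn_integral_distr) auto
  also have "\<dots> = (\<integral>\<^sup>+r. ennreal (?c * r ^ (DIM('a) - 1)) * indicator {0..} r * \<Phi> r \<partial>lborel)"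
    unfolding distr_norm_lborel by (subst nn_integral_density) auto
  \<comment> \<open>The null set \<open>{0}\<close> is dropped here: opposite powers of
    \<open>r\<close> cancel only for positive \<open>r\<close>, since \<open>0 powr a\<close> is
    0.\<close>
  also have "\<dots> = (\<integral>\<^sup>+r. ennreal ?c * (ennreal (r ^ (DIM('a) - 1)) * \<Phi> r * indicator {0<..} r) \<partial>lborel)"
    by (rule nn_integral_cong_AE, rule AE_mp[OF AE_lborel_singleton[of 0]])
      (auto simp: indicator_def ennreal_mult mult_ac)
  also have "\<dots> = ennreal ?c * (\<integral>\<^sup>+r\<in>{0<..}. ennreal (r ^ (DIM('a) - 1)) * \<Phi> r \<partial>lborel)"
    by (subst nn_integral_cmult) auto
  finally show ?thesis .
qed

text \<open>The kernel cancels the Jacobian \<open>r ^ (DIM('a) - 1)\<close> exactly, so the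
  integral is linear in \<open>R\<close>. This is the source of a local error proportional to the
  splitting radius.\<close>

lemma nn_integral_near_kernel:
  fixes R :: real
  assumes "0 \<le> R"
  shows "(\<integral>\<^sup>+x. ennreal (indicator {..R} (norm x) * norm (x::'a::euclidean_space) powr (1 - real DIM('a))) \<partial>lborel) =
    ennreal (real DIM('a) * unit_ball_vol (real DIM('a)) * R)"
proof -
  have "(\<integral>\<^sup>+x. ennreal (indicator {..R} (norm x) * norm (x::'a) powr (1 - real DIM('a))) \<partial>lborel) =
    ennreal (real DIM('a) * unit_ball_vol (real DIM('a))) *
      (\<integral>\<^sup>+r\<in>{0<..}. ennreal (r ^ (DIM('a) - 1)) * ennreal (indicator {..R} r * r powr (1 - real DIM('a))) \<partial>lborel)"
    by (rule nn_integral_radial) auto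
  also have "(\<integral>\<^sup>+r\<in>{0<..}. ennreal (r ^ (DIM('a) - 1)) * ennreal (indicator {..R} r * r powr (1 - real DIM('a))) \<partial>lborel)
    = (\<integral>\<^sup>+r. indicator {0<..R} r \<partial>lborel)"
  proof (rule nn_integral_cong)
    fix r :: real
    have "r ^ (DIM('a) - 1) * r powr (1 - real DIM('a)) = 1" if "r > 0"
    proof -
      have "r ^ (DIM('a) - 1) = r powr (real DIM('a) - 1)"
        using that by (simp add: powr_realpow[symmetric] of_nat_diff Suc_leI)
      then show ?thesis using that by (simp add: powr_add[symmetric])
    qed
    then show "ennreal (r ^ (DIM('a) - 1)) * ennreal (indicator {..R} r * r powr (1 - real DIM('a))) * indicator {0<..} r
      = indicator {0<..R} r"
      by (auto simp: indicator_def ennreal_mult''[symmetric])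
  qed
  also have "\<dots> = ennreal R" using assms by simp
  finally show ?thesis using assms by (simp add: ennreal_mult'')
qed

text \<open>Here the Jacobian leaves the weight \<open>1 / r\<^sup>2\<close>, the one in the
  integrability condition on the growth modulus \<open>\<Omega>\<close>.\<close>

lemma nn_integral_far_kernel:
  fixes R :: real and W :: "real \<Rightarrow> real"
  assumes "0 < R" and [measurable]: "W \<in> borel_measurable borel" and W: "\<And>r. 0 \<le> W r"
  shows "(\<integral>\<^sup>+x. ennreal (indicator {R<..} (norm x) * (W (norm x) * norm (x::'a::euclidean_space) powr - (real DIM('a) + 1))) \<partial>lborel) =
    ennreal (real DIM('a) * unit_ball_vol (real DIM('a))) * (\<integral>\<^sup>+r\<in>{R<..}. ennreal (W r / r\<^sup>2) \<partial>lborel)"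
proof -
  have "(\<integral>\<^sup>+x. ennreal (indicator {R<..} (norm x) * (W (norm x) * norm (x::'a) powr - (real DIM('a) + 1))) \<partial>lborel) =
    ennreal (real DIM('a) * unit_ball_vol (real DIM('a))) *
      (\<integral>\<^sup>+r\<in>{0<..}. ennreal (r ^ (DIM('a) - 1)) * ennreal (indicator {R<..} r * (W r * r powr - (real DIM('a) + 1))) \<partial>lborel)"
    by (rule nn_integral_radial) auto
  also have "(\<integral>\<^sup>+r\<in>{0<..}. ennreal (r ^ (DIM('a) - 1)) * ennreal (indicator {R<..} r * (W r * r powr - (real DIM('a) + 1))) \<partial>lborel)
    = (\<integral>\<^sup>+r\<in>{R<..}. ennreal (W r / r\<^sup>2) \<partial>lborel)"
  proof (rule nn_integral_cong)
    fix r :: real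
    have "r ^ (DIM('a) - 1) * (W r * r powr - (real DIM('a) + 1)) = W r / r\<^sup>2" if "r > 0"
    proof -
      have "r ^ (DIM('a) - 1) = r powr (real DIM('a) - 1)"
        using that by (simp add: powr_realpow[symmetric] of_nat_diff Suc_leI)
      then have "r ^ (DIM('a) - 1) * r powr - (real DIM('a) + 1) = r powr - 2"
        using that by (simp add: powr_add[symmetric])
      also have "\<dots> = 1 / r\<^sup>2" using that by (simp add: powr_minus_divide powr_numeral)
      finally show ?thesis by (simp add: mult_ac)
    qed
    then show "ennreal (r ^ (DIM('a) - 1)) * ennreal (indicator {R<..} r * (W r * r powr - (real DIM('a) + 1))) * indicator {0<..} r
      = ennreal (W r / r\<^sup>2) * indicator {R<..} r"
      using assms(1) by (auto simp: indicator_def ennreal_mult''[symmetric] W)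
  qed
  finally show ?thesis .
qed

subsection \<open>The pointwise kernel\<close>

text \<open>With \<open>m = d\<close> and \<open>H = norm (y - x)\<close> this is the weight in the
  Muskat integrand, seen as a function of the height difference alone.\<close>

definition height_kernel :: "real \<Rightarrow> real \<Rightarrow> real \<Rightarrow> real" where
  "height_kernel m H u = (u\<^sup>2 + H\<^sup>2) powr - (m / 2)"

lemma height_kernel_nonneg: "0 \<le> height_kernel m H u"
  by (simp add: height_kernel_def)

lemma height_kernel_has_derivative:
  assumes "0 < H"
  shows "(height_kernel m H has_real_derivative - m * u * (u\<^sup>2 + H\<^sup>2) powr (- (m / 2) - 1)) (at u)"
proof -
  have "0 < u\<^sup>2 + H\<^sup>2" using assms by (simp add: add_nonneg_pos)
  then show ?thesis unfolding height_kernel_def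
    by (auto intro!: derivative_eq_intros)
qed

lemma sq_powr_half: "0 < H \<Longrightarrow> (H\<^sup>2) powr (a / 2) = H powr a" for H :: real
  by (simp add: powr_numeral[symmetric] powr_powr del: powr_numeral)

lemma height_kernel_zero: "0 < H \<Longrightarrow> height_kernel m H 0 = H powr - m"
  using sq_powr_half[of H "- m"] by (simp add: height_kernel_def)

lemma height_kernel_le:
  assumes "0 < H" "0 \<le> m"
  shows "height_kernel m H u \<le> H powr - m"
  unfolding height_kernel_zero[OF assms(1), symmetric] height_kernel_def using assms
  by (intro powr_mono2') auto

text \<open>In the derivative the factor \<open>z\<close> is at most the square root of
  \<open>z\<^sup>2 + H\<^sup>2\<close>. What remains is the kernel of exponent \<open>m + 1\<close>,
  which is largest at height 0.\<close>

lemma height_kernel_Lipschitz: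
  assumes "0 < H" "0 \<le> m"
  shows "\<bar>height_kernel m H u - height_kernel m H v\<bar> \<le> m * H powr - (m + 1) * \<bar>u - v\<bar>"
proof -
  have "norm (height_kernel m H u - height_kernel m H v) \<le> (m * H powr - (m + 1)) * norm (u - v)"
  proof (rule field_differentiable_bound[where S = UNIV])
    show "(height_kernel m H has_field_derivative - m * z * (z\<^sup>2 + H\<^sup>2) powr (- (m / 2) - 1)) (at z within UNIV)" for z
      using height_kernel_has_derivative[OF assms(1)] by simp
    fix z :: real
    have p: "0 < z\<^sup>2 + H\<^sup>2" using assms by (simp add: add_nonneg_pos)
    have "\<bar>z\<bar> = sqrt (z\<^sup>2)" by simp
    also have "\<dots> \<le> sqrt (z\<^sup>2 + H\<^sup>2)" by (intro real_sqrt_le_mono) simp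
    also have "\<dots> = (z\<^sup>2 + H\<^sup>2) powr (1 / 2)" using p by (simp add: powr_half_sqrt)
    finally have "\<bar>z\<bar> * (z\<^sup>2 + H\<^sup>2) powr (- (m / 2) - 1) \<le>
        (z\<^sup>2 + H\<^sup>2) powr (1 / 2) * (z\<^sup>2 + H\<^sup>2) powr (- (m / 2) - 1)"
      by (intro mult_right_mono) auto
    also have "\<dots> = height_kernel (m + 1) H z"
      unfolding height_kernel_def powr_add[symmetric] by (intro arg_cong2[where f = "(powr)"]) (simp_all add: field_simps)
    also have "\<dots> \<le> H powr - (m + 1)" using assms by (intro height_kernel_le) auto
    finally have "m * (\<bar>z\<bar> * (z\<^sup>2 + H\<^sup>2) powr (- (m / 2) - 1)) \<le> m * H powr - (m + 1)"
      using assms by (intro mult_left_mono) auto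
    then show "norm (- m * z * (z\<^sup>2 + H\<^sup>2) powr (- (m / 2) - 1)) \<le> m * H powr - (m + 1)"
      using assms by (simp add: abs_mult mult_ac)
  qed auto
  then show ?thesis by simp
qed

text \<open>The sign of the derivative in the height difference is that of
  \<open>H\<^sup>2 - (m - 1) u\<^sup>2 + m u p\<close>: this is where the slope bound \<open>1 / sqrt (2 m - 1)\<close> comes from.\<close>

lemma muskat_kernel_mono:
  fixes H L m p u v :: real
  assumes H: "0 < H" and m: "1 \<le> m" and L: "0 \<le> L" "(2 * m - 1) * L\<^sup>2 \<le> 1"
    and p: "\<bar>p\<bar> \<le> L * H" and u: "\<bar>u\<bar> \<le> L * H" and v: "\<bar>v\<bar> \<le> L * H" and le: "u \<le> v"
  shows "(u - p) * height_kernel m H u \<le> (v - p) * height_kernel m H v"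
proof (rule DERIV_nonneg_imp_nondecreasing[OF le, of "\<lambda>u. (u - p) * height_kernel m H u"])
  fix w assume w: "u \<le> w" "w \<le> v"
  have wl: "\<bar>w\<bar> \<le> L * H" using u v w by auto
  have p0: "0 < w\<^sup>2 + H\<^sup>2" using H by (simp add: add_nonneg_pos)
  let ?q = "(w\<^sup>2 + H\<^sup>2) powr (- (m / 2) - 1)"
  have kq: "height_kernel m H w = ?q * (w\<^sup>2 + H\<^sup>2)"
    using p0 by (simp add: height_kernel_def powr_diff)
  have d: "((\<lambda>u. (u - p) * height_kernel m H u) has_real_derivative
      height_kernel m H w + (w - p) * (- m * w * ?q)) (at w)"
    by (auto intro!: derivative_eq_intros height_kernel_has_derivative H)
  have w2: "w\<^sup>2 \<le> L\<^sup>2 * H\<^sup>2"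
    using power_mono[OF wl, of 2] by (simp add: power_mult_distrib)
  have "\<bar>w * p\<bar> \<le> (L * H) * (L * H)"
    unfolding abs_mult using wl p L H by (intro mult_mono) auto
  then have wp: "- (L\<^sup>2 * H\<^sup>2) \<le> w * p" by (simp add: power2_eq_square mult_ac)
  \<comment> \<open>The losses are at most \<open>(m - 1) * L\<^sup>2 * H\<^sup>2\<close> and
    \<open>m * L\<^sup>2 * H\<^sup>2\<close>. Their sum has the factor \<open>2 * m - 1\<close>, so
    the slope hypothesis bounds it by \<open>H\<^sup>2\<close>.\<close>
  have "(m - 1) * w\<^sup>2 \<le> (m - 1) * (L\<^sup>2 * H\<^sup>2)" using m w2 by (intro mult_left_mono) auto
  moreover have "m * - (L\<^sup>2 * H\<^sup>2) \<le> m * (w * p)" using m wp by (intro mult_left_mono) auto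
  moreover have "(2 * m - 1) * L\<^sup>2 * H\<^sup>2 \<le> 1 * H\<^sup>2" using L by (intro mult_right_mono) auto
  ultimately have "0 \<le> w\<^sup>2 + H\<^sup>2 - m * w * (w - p)"
    by (simp add: algebra_simps power2_eq_square)
  then have "0 \<le> ?q * (w\<^sup>2 + H\<^sup>2 - m * w * (w - p))" by simp
  also have "\<dots> = height_kernel m H w + (w - p) * (- m * w * ?q)"
    unfolding kq by (simp add: algebra_simps)
  finally show "\<exists>y. ((\<lambda>u. (u - p) * height_kernel m H u) has_real_derivative y) (at w) \<and> 0 \<le> y"
    using d by blast
qed

text \<open>Neither \<open>u - p\<close> nor \<open>v - q\<close> is bounded from both sides, but monotonicity allows
  replacing \<open>u - p\<close> by its truncation \<open>A\<close> from below at \<open>- K H\<^sup>2\<close> and \<open>v - q\<close> by \<open>A - s\<close>.\<close>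

lemma muskat_kernel_near:
  fixes H L L' m p q u v K s b :: real
  assumes H: "0 < H" and m: "1 \<le> m" and b: "0 \<le> b" and L: "0 \<le> L" "L + 3 * b \<le> L'"
    and L': "(2 * m - 1) * L'\<^sup>2 \<le> 1"
    and p: "\<bar>p\<bar> \<le> L * H" and q: "\<bar>q\<bar> \<le> L * H" and u: "\<bar>u\<bar> \<le> L * H" and v: "\<bar>v\<bar> \<le> L * H"
    and pq: "\<bar>p - q\<bar> \<le> b * H"
    and s: "0 \<le> s" "s \<le> b * H\<^sup>2 / 2" "s \<le> 2 * b * H"
    and le: "u - p \<le> v - q + s" and K: "0 \<le> K" "u - p \<le> K * H\<^sup>2" "- (K * H\<^sup>2) \<le> v - q"
  shows "(u - p) * height_kernel m H u - (v - q) * height_kernel m H v \<le> b * (3 * m * K + 1 / 2) * H powr (1 - (m - 1))"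
proof -
  define A where "A = max (u - p) (- (K * H\<^sup>2))"
  have bH: "0 \<le> b * H" using b H by simp
  have L'H: "L * H + 3 * (b * H) \<le> L' * H"
    using mult_right_mono[OF L(2), of H] H by (simp add: algebra_simps)
  have L'0: "0 \<le> L'" using L b by simp
  have "0 \<le> K * H\<^sup>2" using K by simp
  then have A1: "\<bar>A\<bar> \<le> K * H\<^sup>2" unfolding A_def using K by linarith
  have A2: "u - p \<le> A" "A \<le> v - q + s" using le K s by (auto simp: A_def)
  \<comment> \<open>The modified heights lie between the old ones up to \<open>b * H\<close> from
    \<open>p - q\<close> and \<open>2 * b * H\<close> from \<open>s\<close>. This explains the room
    \<open>3 * b\<close> between \<open>L\<close> and \<open>L'\<close>, within which the kernel is
    still monotone.\<close>
  have "\<bar>A + p\<bar> \<le> L' * H" "\<bar>A - s + q\<bar> \<le> L' * H"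
    using A2 u v pq s L'H bH by linarith+
  note bnds = this
  have LL: "L * H \<le> L' * H" using L'H bH by linarith
  have "(u - p) * height_kernel m H u \<le> (A + p - p) * height_kernel m H (A + p)"
    using A2 bnds p u LL by (intro muskat_kernel_mono[OF H m L'0 L']) auto
  moreover have "(A - s + q - q) * height_kernel m H (A - s + q) \<le> (v - q) * height_kernel m H v"
    using A2 bnds q v LL by (intro muskat_kernel_mono[OF H m L'0 L']) auto
  ultimately have "(u - p) * height_kernel m H u - (v - q) * height_kernel m H v \<le>
      A * height_kernel m H (A + p) - (A - s) * height_kernel m H (A - s + q)" by simp
  also have "\<dots> = A * (height_kernel m H (A + p) - height_kernel m H (A - s + q)) + s * height_kernel m H (A - s + q)"
    by (simp add: algebra_simps)
  \<comment> \<open>The first term pairs a factor of size \<open>K * H\<^sup>2\<close> with a kernel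
    increment over a height change of at most \<open>3 * b * H\<close>. In the second, the quadratic
    bound on \<open>s\<close> supplies the power of \<open>H\<close> needed at the origin.\<close>
  also have "\<dots> \<le> K * H\<^sup>2 * (m * H powr - (m + 1) * (3 * b * H)) + b * H\<^sup>2 / 2 * H powr - m"
  proof (rule add_mono)
    have "\<bar>height_kernel m H (A + p) - height_kernel m H (A - s + q)\<bar> \<le> m * H powr - (m + 1) * \<bar>(A + p) - (A - s + q)\<bar>"
      using m by (intro height_kernel_Lipschitz H) auto
    also have "\<dots> \<le> m * H powr - (m + 1) * (3 * b * H)"
      using m s pq by (intro mult_left_mono) auto
    finally have "\<bar>A\<bar> * \<bar>height_kernel m H (A + p) - height_kernel m H (A - s + q)\<bar> \<le> K * H\<^sup>2 * (m * H powr - (m + 1) * (3 * b * H))"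
      using A1 K by (intro mult_mono) auto
    then show "A * (height_kernel m H (A + p) - height_kernel m H (A - s + q)) \<le> K * H\<^sup>2 * (m * H powr - (m + 1) * (3 * b * H))"
      unfolding abs_mult[symmetric] by linarith
    show "s * height_kernel m H (A - s + q) \<le> b * H\<^sup>2 / 2 * H powr - m"
      using s m b by (intro mult_mono height_kernel_le H height_kernel_nonneg) auto
  qed
  also have "\<dots> = b * (3 * m * K + 1 / 2) * (H\<^sup>2 * H powr - m)"
  proof -
    have "H powr - (m + 1) * H = H powr - m"
      using H by (simp add: powr_diff)
    then have *: "x * H * H powr - (m + 1) = x * H powr - m" for x by (metis mult.assoc mult.commute)
    have "K * H\<^sup>2 * (m * H powr - (m + 1) * (3 * b * H)) = 3 * K * H\<^sup>2 * m * b * H * H powr - (m + 1)"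
      by (simp add: algebra_simps)
    then show ?thesis unfolding * by (simp add: algebra_simps)
  qed
  \<comment> \<open>The exponent is written in terms of the dimension \<open>m - 1\<close> to match
    the integrable near kernel.\<close>
  also have "H\<^sup>2 * H powr - m = H powr (1 - (m - 1))"
    using H by (simp add: powr_diff powr_minus_divide powr_numeral)
  finally show ?thesis .
qed

text \<open>At large distance each term is compared with \<open>- p * H powr - m\<close>, where the
  kernel is frozen at height 0; the Lipschitz bound and \<open>\<bar>p\<bar> \<le> L * H\<close>
  control the error. The remaining linear term is odd in the displacement once \<open>p\<close> and
  \<open>q\<close> are gradient terms.\<close>

lemma muskat_kernel_far:
  fixes H L m p q u v :: real
  assumes H: "0 < H" and m: "1 \<le> m" and L: "0 \<le> L"
    and p: "\<bar>p\<bar> \<le> L * H" and q: "\<bar>q\<bar> \<le> L * H"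
  shows "(u - p) * height_kernel m H u - (v - q) * height_kernel m H v \<le>
    (1 + m * L) * (\<bar>u\<bar> + \<bar>v\<bar>) * H powr - m - (p - q) * H powr - m"
proof -
  have *: "\<bar>(u - p) * height_kernel m H u + p * H powr - m\<bar> \<le> (1 + m * L) * \<bar>u\<bar> * H powr - m"
    if p: "\<bar>p\<bar> \<le> L * H" for u p
  proof -
    have "\<bar>u\<bar> * height_kernel m H u \<le> \<bar>u\<bar> * H powr - m"
      using m by (intro mult_left_mono height_kernel_le H) auto
    moreover have "\<bar>p\<bar> * \<bar>height_kernel m H 0 - height_kernel m H u\<bar> \<le> (L * H) * (m * H powr - (m + 1) * \<bar>0 - u\<bar>)"
      using m p L H by (intro mult_mono height_kernel_Lipschitz) auto
    moreover have "(L * H) * (m * H powr - (m + 1) * \<bar>0 - u\<bar>) = m * L * \<bar>u\<bar> * H powr - m"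
    proof -
      have "H powr - (m + 1) * H = H powr - m" using H by (simp add: powr_diff)
      then have *: "x * H * H powr - (m + 1) = x * H powr - m" for x by (metis mult.assoc mult.commute)
      have "(L * H) * (m * H powr - (m + 1) * \<bar>0 - u\<bar>) = m * L * \<bar>u\<bar> * H * H powr - (m + 1)" by simp
      then show ?thesis unfolding * .
    qed
    moreover have "(u - p) * height_kernel m H u + p * H powr - m = u * height_kernel m H u + p * (height_kernel m H 0 - height_kernel m H u)"
      by (simp add: height_kernel_zero[OF H] algebra_simps)
    moreover have "\<bar>u * height_kernel m H u + p * (height_kernel m H 0 - height_kernel m H u)\<bar> \<le> \<bar>u\<bar> * height_kernel m H u + \<bar>p\<bar> * \<bar>height_kernel m H 0 - height_kernel m H u\<bar>"
      using abs_triangle_ineq[of "u * height_kernel m H u" "p * (height_kernel m H 0 - height_kernel m H u)"] height_kernel_nonneg[of m H u]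
      by (simp add: abs_mult)
    ultimately have "\<bar>(u - p) * height_kernel m H u + p * H powr - m\<bar> \<le> \<bar>u\<bar> * H powr - m + m * L * \<bar>u\<bar> * H powr - m"
      by linarith
    then show ?thesis by (simp add: algebra_simps)
  qed
  show ?thesis using *[OF p, of u] *[OF q, of v] by (simp add: algebra_simps abs_le_iff)
qed

subsection \<open>Principal values and the nonlocal comparison\<close>

lemma integral_lborel_uminus:
  fixes f :: "'a::euclidean_space \<Rightarrow> real"
  assumes "f \<in> borel_measurable borel"
  shows "(LINT x|lborel. f (- x)) = (LINT x|lborel. f x)"
proof -
  have d: "distr lborel borel uminus = (lborel :: 'a measure)"
    using lborel_affine[of "-1" "0::'a"] by (simp add: density_1)
  have "(LINT x|lborel. f (- x)) = integral\<^sup>L (distr lborel borel uminus) f"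
    using assms by (simp add: integral_distr)
  then show ?thesis by (simp add: d)
qed

lemma eventually_pv_radii:
  assumes "0 < R\<^sub>0"
  shows "\<forall>\<^sub>F p in at_right (0::real) \<times>\<^sub>F at_top. 0 < fst p \<and> fst p < R\<^sub>0 \<and> (R\<^sub>0::real) < snd p"
proof -
  have "\<forall>\<^sub>F \<epsilon> in at_right 0. 0 < \<epsilon> \<and> \<epsilon> < R\<^sub>0"
    using assms by (auto simp: eventually_at_right_field)
  then show ?thesis
    unfolding eventually_prod_filter
    by (intro exI[of _ "\<lambda>\<epsilon>. 0 < \<epsilon> \<and> \<epsilon> < R\<^sub>0"] exI[of _ "\<lambda>R. R\<^sub>0 < R"])
      (auto simp: eventually_gt_at_top)
qed

lemma has_pv_integral_translate:
  fixes \<phi> :: "'a::euclidean_space \<Rightarrow> real"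
  assumes "has_pv_integral \<phi> I x"
  shows "\<And>\<epsilon> R. 0 < \<epsilon> \<Longrightarrow> \<epsilon> < R \<Longrightarrow>
      set_integrable lborel {h. \<epsilon> < norm h \<and> norm h < R} (\<lambda>h. \<phi> (x + h))"
    and "((\<lambda>(\<epsilon>, R). LINT h:{h. \<epsilon> < norm h \<and> norm h < R}|lborel. \<phi> (x + h)) \<longlongrightarrow> I)
      (at_right 0 \<times>\<^sub>F at_top)"
proof -
  let ?A = "\<lambda>\<epsilon> R. {y. \<epsilon> < dist x y \<and> dist x y < R}" and ?B = "\<lambda>\<epsilon> R. {h::'a. \<epsilon> < norm h \<and> norm h < R}"
  have d: "distr lborel borel ((+) x) = lborel"
    using lborel_affine[of 1 x] by (simp add: density_1)
  have ind: "indicat_real (?A \<epsilon> R) (x + h) = indicator (?B \<epsilon> R) h" for \<epsilon> R h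
    by (auto simp: indicator_def dist_norm)
  have int: "integrable lborel (\<lambda>y. indicator (?A \<epsilon> R) y *\<^sub>R \<phi> y)" if "0 < \<epsilon>" "\<epsilon> < R" for \<epsilon> R
    using assms that by (auto simp: has_pv_integral_def set_integrable_def)
  have int': "integrable lborel (\<lambda>h. indicator (?B \<epsilon> R) h *\<^sub>R \<phi> (x + h))"
    and eq: "(LINT y:?A \<epsilon> R|lborel. \<phi> y) = (LINT h:?B \<epsilon> R|lborel. \<phi> (x + h))"
    if "0 < \<epsilon>" "\<epsilon> < R" for \<epsilon> R
  proof -
    have i: "integrable (distr lborel borel ((+) x)) (\<lambda>y. indicator (?A \<epsilon> R) y *\<^sub>R \<phi> y)"
      unfolding d using int[OF that] .
    from integrable_distr[OF _ i] show "integrable lborel (\<lambda>h. indicator (?B \<epsilon> R) h *\<^sub>R \<phi> (x + h))"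
      by (simp add: ind)
    have "integral\<^sup>L (distr lborel borel ((+) x)) (\<lambda>y. indicator (?A \<epsilon> R) y *\<^sub>R \<phi> y) =
        integral\<^sup>L lborel (\<lambda>h. indicator (?A \<epsilon> R) (x + h) *\<^sub>R \<phi> (x + h))"
      using int[OF that] by (intro integral_distr) auto
    then show "(LINT y:?A \<epsilon> R|lborel. \<phi> y) = (LINT h:?B \<epsilon> R|lborel. \<phi> (x + h))"
      unfolding d by (simp add: ind set_lebesgue_integral_def)
  qed
  show "set_integrable lborel (?B \<epsilon> R) (\<lambda>h. \<phi> (x + h))" if "0 < \<epsilon>" "\<epsilon> < R" for \<epsilon> R
    using int'[OF that] by (simp add: set_integrable_def)
  have "((\<lambda>(\<epsilon>, R). LINT y:?A \<epsilon> R|lborel. \<phi> y) \<longlongrightarrow> I) (at_right 0 \<times>\<^sub>F at_top)"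
    using assms by (simp add: has_pv_integral_def)
  moreover have "\<forall>\<^sub>F p in at_right 0 \<times>\<^sub>F at_top. (case p of (\<epsilon>, R) \<Rightarrow> LINT y:?A \<epsilon> R|lborel. \<phi> y) =
      (case p of (\<epsilon>, R) \<Rightarrow> LINT h:?B \<epsilon> R|lborel. \<phi> (x + h))"
    using eventually_pv_radii[of 1] by (rule eventually_mono) (auto simp: eq)
  ultimately show "((\<lambda>(\<epsilon>, R). LINT h:?B \<epsilon> R|lborel. \<phi> (x + h)) \<longlongrightarrow> I) (at_right 0 \<times>\<^sub>F at_top)"
    using tendsto_cong by force
qed

text \<open>The two principal values are centred at different points. Translation brings both to the
  same annulus in \<open>h\<close>, where the integrands are subtracted before the limit; this keeps
  their cancellation near the centre.\<close>

lemma pv_integral_diff_le: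
  fixes \<phi> \<psi> :: "'a::euclidean_space \<Rightarrow> real"
  assumes "has_pv_integral \<phi> I x" "has_pv_integral \<psi> J y" and "0 < R\<^sub>0"
    and le: "\<And>\<epsilon> R. 0 < \<epsilon> \<Longrightarrow> \<epsilon> < R\<^sub>0 \<Longrightarrow> R\<^sub>0 < R \<Longrightarrow>
      integrable lborel (\<lambda>h. indicator {h. \<epsilon> < norm h \<and> norm h < R} h * (\<phi> (x + h) - \<psi> (y + h))) \<Longrightarrow>
      (LINT h|lborel. indicator {h. \<epsilon> < norm h \<and> norm h < R} h * (\<phi> (x + h) - \<psi> (y + h))) \<le> E"
  shows "I - J \<le> E"
proof -
  let ?B = "\<lambda>\<epsilon> R. {h::'a. \<epsilon> < norm h \<and> norm h < R}"
  note I = has_pv_integral_translate[OF assms(1)] and J = has_pv_integral_translate[OF assms(2)]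
  have "((\<lambda>p. (case p of (\<epsilon>, R) \<Rightarrow> LINT h:?B \<epsilon> R|lborel. \<phi> (x + h)) -
      (case p of (\<epsilon>, R) \<Rightarrow> LINT h:?B \<epsilon> R|lborel. \<psi> (y + h))) \<longlongrightarrow> I - J) (at_right 0 \<times>\<^sub>F at_top)"
    by (intro tendsto_diff I(2) J(2))
  moreover have "\<forall>\<^sub>F p in at_right 0 \<times>\<^sub>F at_top. (case p of (\<epsilon>, R) \<Rightarrow> LINT h:?B \<epsilon> R|lborel. \<phi> (x + h)) -
      (case p of (\<epsilon>, R) \<Rightarrow> LINT h:?B \<epsilon> R|lborel. \<psi> (y + h)) \<le> E"
  proof -
    from eventually_pv_radii[OF \<open>0 < R\<^sub>0\<close>] show ?thesis
    proof eventually_elim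
      case (elim p)
      obtain \<epsilon> R where p: "p = (\<epsilon>, R)" by fastforce
      with elim have e: "0 < \<epsilon>" "\<epsilon> < R\<^sub>0" "R\<^sub>0 < R" "\<epsilon> < R" by auto
      note i = I(1)[OF e(1,4)] J(1)[OF e(1,4)]
      have eq: "indicator (?B \<epsilon> R) h *\<^sub>R (\<phi> (x + h) - \<psi> (y + h)) = indicator (?B \<epsilon> R) h * (\<phi> (x + h) - \<psi> (y + h))" for h
        by simp
      have "(LINT h:?B \<epsilon> R|lborel. \<phi> (x + h)) - (LINT h:?B \<epsilon> R|lborel. \<psi> (y + h)) =
          (LINT h:?B \<epsilon> R|lborel. \<phi> (x + h) - \<psi> (y + h))"
        using i by (simp add: set_integral_diff)
      also have "\<dots> \<le> E"
        using le[OF e(1,2,3)] set_integral_diff(1)[OF i]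
        unfolding set_lebesgue_integral_def set_integrable_def eq by blast
      finally show ?case by (simp add: p)
    qed
  qed
  ultimately show ?thesis
    by (rule tendsto_upperbound) (simp add: prod_filter_eq_bot)
qed

text \<open>The reflection \<open>h \<mapsto> - h\<close> preserves the annulus and changes the
  sign. Restriction to an annulus matters: for \<open>a = - (DIM('a) + 1)\<close> the integrand
  decays only like \<open>norm h powr - DIM('a)\<close>, which is not absolutely integrable at
  infinity unless it vanishes.\<close>

lemma odd_kernel_integral:
  fixes q :: "'a::euclidean_space"
  assumes "0 < R\<^sub>0"
  shows "integrable lborel (\<lambda>h. indicator {h. R\<^sub>0 < norm h \<and> norm h < R} h * ((q \<bullet> h) * norm h powr a))"
      (is "integrable _ ?G")
    and "(LINT h|lborel. indicator {h. R\<^sub>0 < norm h \<and> norm h < R} h * ((q \<bullet> h) * norm h powr a)) = 0"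
proof -
  let ?A = "{h::'a. R\<^sub>0 < norm h \<and> norm h < R}"
  let ?C = "max (R\<^sub>0 powr a) (R powr a)"
  have "integrable lborel (\<lambda>h. indicator ?A h *\<^sub>R ((q \<bullet> h) * norm h powr a))"
  proof (rule integrableI_bounded_set_indicator[where B = "norm q * R * ?C"])
    have "emeasure lborel ?A \<le> emeasure lborel (cball (0::'a) R)"
      by (intro emeasure_mono) auto
    also have "\<dots> < \<infinity>" by (rule emeasure_bounded_finite[OF bounded_cball])
    finally show "emeasure lborel ?A < \<infinity>" .
    show "AE h in lborel. h \<in> ?A \<longrightarrow> norm ((q \<bullet> h) * norm h powr a) \<le> norm q * R * ?C"
    proof (rule AE_I2, intro impI)
      fix h assume h: "h \<in> ?A"
      have "norm h powr a \<le> ?C"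
      proof (cases "0 \<le> a")
        case True
        then have "norm h powr a \<le> R powr a" using h by (intro powr_mono2) auto
        then show ?thesis by simp
      next
        case False
        then have "norm h powr a \<le> R\<^sub>0 powr a" using h assms by (intro powr_mono2') auto
        then show ?thesis by simp
      qed
      moreover have "\<bar>q \<bullet> h\<bar> \<le> norm q * R"
        using Cauchy_Schwarz_ineq2[of q h] h
        by (smt (verit) mem_Collect_eq mult_left_mono norm_ge_zero)
      ultimately show "norm ((q \<bullet> h) * norm h powr a) \<le> norm q * R * ?C"
        using h unfolding real_norm_def abs_mult[of "q \<bullet> h"] by (intro mult_mono) auto
    qed
  qed auto
  then show "integrable lborel ?G" by simp
  have "(LINT h|lborel. ?G (- h)) = (LINT h|lborel. ?G h)" by (rule integral_lborel_uminus) measurable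
  moreover have "(LINT h|lborel. ?G (- h)) = (LINT h|lborel. - ?G h)"
    by (intro Bochner_Integration.integral_cong) (auto simp: indicator_def)
  moreover have "(LINT h|lborel. - ?G h) = - (LINT h|lborel. ?G h)" by (rule integral_minus)
  ultimately show "(LINT h|lborel. ?G h) = 0" by linarith
qed

text \<open>The annulus is split at \<open>R\<close>. Inside, the touching condition gives a
  multiple of \<open>b\<close> times the near kernel; outside, heights are bounded by
  \<open>W\<close> and the gradient term integrates to zero. The constant \<open>c\<close> is the
  area of the unit sphere.\<close>

lemma muskat_nonlocal_comparison:
  fixes u v :: "real ^ 'n \<Rightarrow> real" and x y :: "real ^ 'n"
  defines "m \<equiv> real CARD('n) + 1"
  defines "c \<equiv> real CARD('n) * unit_ball_vol (real CARD('n))"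
  assumes I: "has_pv_integral (muskat_integrand u x) I x" and J: "has_pv_integral (muskat_integrand v y) J y"
    and L: "0 \<le> L" "L + 3 * b \<le> L'" "(2 * m - 1) * L'\<^sup>2 \<le> 1" and b: "0 \<le> b"
    and u: "\<And>h. \<bar>u (x + h) - u x\<bar> \<le> L * norm h" and v: "\<And>h. \<bar>v (y + h) - v y\<bar> \<le> L * norm h"
    and gu: "norm (grad u x) \<le> L" and gv: "norm (grad v y) \<le> L" and guv: "norm (grad u x - grad v y) \<le> b"
    and touch: "\<And>h. u (x + h) - u x - grad u x \<bullet> h \<le>
      v (y + h) - v y - grad v y \<bullet> h + b * min ((norm h)\<^sup>2 / 2) (2 * norm h)"
    and K: "0 \<le> K" "\<And>h. u (x + h) - u x - grad u x \<bullet> h \<le> K * (norm h)\<^sup>2"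
      "\<And>h. - (K * (norm h)\<^sup>2) \<le> v (y + h) - v y - grad v y \<bullet> h"
    and R: "0 < R" and W[measurable]: "W \<in> borel_measurable borel" and W0: "\<And>r. 0 \<le> W r"
    and uW: "\<And>h. R < norm h \<Longrightarrow> \<bar>u (x + h) - u x\<bar> + \<bar>v (y + h) - v y\<bar> \<le> W (norm h)"
    and tau: "0 \<le> \<tau>" "(\<integral>\<^sup>+r\<in>{R<..}. ennreal (W r / r\<^sup>2) \<partial>lborel) \<le> ennreal \<tau>"
  shows "I - J \<le> c * (b * (3 * m * K + 1 / 2) * R + (1 + m * L) * \<tau>)"
proof (rule pv_integral_diff_le[OF I J R])
  fix \<epsilon> R' :: real
  assume e: "0 < \<epsilon>" "\<epsilon> < R" "R < R'"
  let ?A = "{h::real ^ 'n. \<epsilon> < norm h \<and> norm h < R'}"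
  let ?F = "\<lambda>h. muskat_integrand u x (x + h) - muskat_integrand v y (y + h)"
  let ?G1 = "\<lambda>h::real ^ 'n. indicator {..R} (norm h) * norm h powr (1 - real DIM(real ^ 'n))"
  let ?G2 = "\<lambda>h::real ^ 'n. indicator {R<..} (norm h) * (W (norm h) * norm h powr - (real DIM(real ^ 'n) + 1))"
  let ?q = "grad u x - grad v y"
  let ?G3 = "\<lambda>h::real ^ 'n. indicator {h. R < norm h \<and> norm h < R'} h * ((?q \<bullet> h) * norm h powr - m)"
  let ?a = "b * (3 * m * K + 1 / 2)" and ?b = "1 + m * L"
  assume int: "integrable lborel (\<lambda>h. indicator ?A h * ?F h)"
  have m1: "1 \<le> m" by (simp add: m_def)
  have a0: "0 \<le> ?a" "0 \<le> ?b" "0 \<le> c" using b K m1 L by (auto simp: c_def intro!: mult_nonneg_nonneg add_nonneg_nonneg)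
  have F: "?F h = ((u (x + h) - u x) - grad u x \<bullet> h) * height_kernel m (norm h) (u (x + h) - u x) -
      ((v (y + h) - v y) - grad v y \<bullet> h) * height_kernel m (norm h) (v (y + h) - v y)" for h
    by (simp add: muskat_integrand_def height_kernel_def m_def powr_minus_divide)
  have G1: "integrable lborel ?G1" "integral\<^sup>L lborel ?G1 \<le> c * R"
  proof -
    have i: "(\<integral>\<^sup>+h. ennreal (?G1 h) \<partial>lborel) = ennreal (c * R)"
      using nn_integral_near_kernel[of R, where 'a = "real ^ 'n"] R by (simp add: c_def)
    show "integrable lborel ?G1"
      by (rule integrableI_bounded) (use i in auto)
    show "integral\<^sup>L lborel ?G1 \<le> c * R"
      using i R a0 by (intro integral_real_bounded) auto
  qed
  have G2: "integrable lborel ?G2" "integral\<^sup>L lborel ?G2 \<le> c * \<tau>"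
  proof -
    have "(\<integral>\<^sup>+h. ennreal (?G2 h) \<partial>lborel) = ennreal c * (\<integral>\<^sup>+r\<in>{R<..}. ennreal (W r / r\<^sup>2) \<partial>lborel)"
      using nn_integral_far_kernel[OF R W W0, where 'a = "real ^ 'n"] by (simp add: c_def)
    also have "\<dots> \<le> ennreal c * ennreal \<tau>" by (intro mult_left_mono tau) auto
    finally have i: "(\<integral>\<^sup>+h. ennreal (?G2 h) \<partial>lborel) \<le> ennreal (c * \<tau>)"
      using a0 by (simp add: ennreal_mult')
    have n: "norm (?G2 h) = ?G2 h" for h using W0 by simp
    show "integrable lborel ?G2"
    proof (rule integrableI_bounded)
      show "(\<integral>\<^sup>+h. ennreal (norm (?G2 h)) \<partial>lborel) < \<infinity>"
        unfolding n using i by (rule le_less_trans) simp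
    qed simp
    show "integral\<^sup>L lborel ?G2 \<le> c * \<tau>"
      using i a0 tau by (intro integral_real_bounded) auto
  qed
  note G3 = odd_kernel_integral[OF R, of R' ?q "- m"]
  \<comment> \<open>One pointwise bound covers both regions: \<open>?G1\<close> lives inside radius
    \<open>R\<close>, while \<open>?G2\<close> and the odd term \<open>?G3\<close> live
    outside.\<close>
  have pt: "indicator ?A h * ?F h \<le> ?a * ?G1 h + ?b * ?G2 h - ?G3 h" for h
  proof (cases "h \<in> ?A")
    case False
    then have "?G3 h = 0" using e by auto
    moreover have "0 \<le> ?a * ?G1 h" "0 \<le> ?b * ?G2 h" using a0 W0 by simp_all
    ultimately show ?thesis using False by auto
  next
    case True
    then have h: "0 < norm h" using e by auto
    have pu: "\<bar>grad u x \<bullet> h\<bar> \<le> L * norm h" and pv: "\<bar>grad v y \<bullet> h\<bar> \<le> L * norm h"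
      and q: "\<bar>grad u x \<bullet> h - grad v y \<bullet> h\<bar> \<le> b * norm h"
      unfolding inner_diff_left[symmetric]
      by (rule order_trans[OF Cauchy_Schwarz_ineq2], intro mult_right_mono gu gv guv, simp)+
    show ?thesis
    proof (cases "norm h \<le> R")
      case le: True
      \<comment> \<open>The slack \<open>s\<close> is the minimum in \<open>touch\<close>: its
        quadratic branch gives integrability at the origin, its linear branch keeps the modified
        slopes below \<open>L'\<close>.\<close>
      have "?F h \<le> ?a * norm h powr (1 - (m - 1))"
        unfolding F
        by (rule muskat_kernel_near[where s = "b * min ((norm h)\<^sup>2 / 2) (2 * norm h)", OF h m1 b L pu pv u v q])
          (use touch[of h] K b in \<open>auto simp: min_def mult_left_mono algebra_simps\<close>)
      then show ?thesis using True le by (simp add: m_def)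
    next
      case False
      have "?F h \<le> ?b * (\<bar>u (x + h) - u x\<bar> + \<bar>v (y + h) - v y\<bar>) * norm h powr - m -
          (grad u x \<bullet> h - grad v y \<bullet> h) * norm h powr - m"
        unfolding F by (rule muskat_kernel_far[OF h m1 L(1) pu pv])
      also have "\<dots> \<le> ?b * W (norm h) * norm h powr - m - (grad u x \<bullet> h - grad v y \<bullet> h) * norm h powr - m"
        using uW[of h] False a0 by (intro diff_right_mono mult_right_mono mult_left_mono) auto
      finally show ?thesis using True False by (simp add: m_def inner_diff_left mult.assoc)
    qed
  qed
  have "(LINT h|lborel. indicator ?A h * ?F h) \<le> (LINT h|lborel. ?a * ?G1 h + ?b * ?G2 h - ?G3 h)"
    by (rule integral_mono[OF int _ pt])
      (intro Bochner_Integration.integrable_diff Bochner_Integration.integrable_add integrable_mult_right G1 G2 G3)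
  also have "\<dots> = ?a * integral\<^sup>L lborel ?G1 + ?b * integral\<^sup>L lborel ?G2"
    using G1(1) G2(1) G3 by simp
  also have "\<dots> \<le> ?a * (c * R) + ?b * (c * \<tau>)"
    using a0 G1 G2 by (intro add_mono mult_left_mono) auto
  finally show "(LINT h|lborel. indicator ?A h * ?F h) \<le> c * (?a * R + ?b * \<tau>)"
    by (simp add: algebra_simps)
qed

subsection \<open>Doubling the space variable\<close>

text \<open>Along the line through \<open>x\<close> in direction \<open>D - p\<close>, subtracting
  the paraboloid leaves a function with a maximum at 0. Its derivative there is the squared norm of
  \<open>D - p\<close>.\<close>

lemma gderiv_eq_of_quadratic_touch:
  fixes u :: "'a::euclidean_space \<Rightarrow> real"
  assumes D: "GDERIV u x :> D" and touch: "\<And>h. u (x + h) - u x \<le> p \<bullet> h + C * (norm h)\<^sup>2"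
  shows "D = p"
proof -
  define w where "w = D - p"
  define \<phi> where "\<phi> s = u (x + s *\<^sub>R w) - s * (p \<bullet> w) - C * s\<^sup>2 * (norm w)\<^sup>2" for s :: real
  have "(u has_derivative (\<lambda>h. h \<bullet> D)) (at (x + 0 *\<^sub>R w))"
    using D by (simp add: gderiv_def)
  then have "((\<lambda>s. u (x + s *\<^sub>R w)) has_derivative (\<lambda>s. (s *\<^sub>R w) \<bullet> D)) (at 0)"
    by (rule has_derivative_compose[rotated]) (auto intro!: derivative_eq_intros)
  then have "((\<lambda>s. u (x + s *\<^sub>R w)) has_real_derivative w \<bullet> D) (at 0)"
    by (simp add: has_field_derivative_def mult_commute_abs)
  then have "(\<phi> has_real_derivative w \<bullet> D - p \<bullet> w) (at 0)"
    unfolding \<phi>_def by (auto intro!: derivative_eq_intros)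
  moreover have "\<phi> s \<le> \<phi> 0" for s
    using touch[of "s *\<^sub>R w"] by (simp add: \<phi>_def power_mult_distrib)
  ultimately have "w \<bullet> D - p \<bullet> w = 0"
    by (intro DERIV_local_max[where d = 1]) auto
  then have "w \<bullet> w = 0" by (simp add: w_def inner_diff inner_commute)
  then show ?thesis by (simp add: w_def)
qed

text \<open>Only earlier times are compared, because the maximum may occur at the final
  time.\<close>

lemma DERIV_nonneg_at_left_max:
  fixes F :: "real \<Rightarrow> real"
  assumes D: "(F has_real_derivative D) (at t)" and a: "a < t" and le: "\<And>s. a \<le> s \<Longrightarrow> s \<le> t \<Longrightarrow> F s \<le> F t"
  shows "0 \<le> D"
proof (rule ccontr)
  assume "\<not> 0 \<le> D"
  then obtain d where d: "d > 0" "\<And>h. h > 0 \<Longrightarrow> h < d \<Longrightarrow> F t < F (t - h)"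
    using DERIV_neg_dec_left[OF D] by auto
  define h where "h = min (d / 2) (t - a)"
  have "0 < h" "h < d" "a \<le> t - h" using d(1) a by (auto simp: h_def)
  then show False using d(2)[of h] le[of "t - h"] by simp
qed

text \<open>A smooth substitute for the norm: linear growth, with first and second derivatives
  bounded by 1.\<close>

definition bracket :: "'a::euclidean_space \<Rightarrow> real" where
  "bracket x = sqrt (1 + (norm x)\<^sup>2)"

lemma bracket_ge: "1 \<le> bracket x" "norm x \<le> bracket x"
  by (auto simp: bracket_def intro!: real_le_rsqrt)

lemma continuous_on_bracket: "continuous_on S bracket"
  unfolding bracket_def by (intro continuous_intros)

text \<open>The quadratic bound is the inequality
  \<open>2 * a * b \<le> a\<^sup>2 + b\<^sup>2\<close> for the two brackets. The linear bound holds
  because \<open>bracket x\<close> is the norm of \<open>(1, x)\<close>, hence 1-Lipschitz, and the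
  gradient \<open>x / bracket x\<close> has norm at most 1.\<close>

lemma bracket_add_le:
  "bracket (x + h) - bracket x \<le> (x \<bullet> h) / bracket x + min ((norm h)\<^sup>2 / 2) (2 * norm h)"
proof -
  have b1: "1 \<le> bracket x" by (rule bracket_ge)
  have sq: "(bracket y)\<^sup>2 = 1 + (norm y)\<^sup>2" for y :: 'a by (simp add: bracket_def)
  have e: "(bracket (x + h))\<^sup>2 = (bracket x)\<^sup>2 + 2 * (x \<bullet> h) + (norm h)\<^sup>2"
    unfolding sq by (simp add: power2_norm_eq_inner algebra_simps inner_commute)
  have "2 * (bracket (x + h) * bracket x) \<le> (bracket (x + h))\<^sup>2 + (bracket x)\<^sup>2"
    using sum_squares_bound[of "bracket (x + h)" "bracket x"] by simp
  then have "bracket (x + h) * bracket x \<le> (bracket x)\<^sup>2 + (x \<bullet> h) + (norm h)\<^sup>2 / 2"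
    unfolding e by simp
  then have "bracket (x + h) \<le> ((bracket x)\<^sup>2 + (x \<bullet> h) + (norm h)\<^sup>2 / 2) / bracket x"
    using b1 by (simp add: le_divide_eq)
  also have "\<dots> = bracket x + (x \<bullet> h) / bracket x + (norm h)\<^sup>2 / 2 / bracket x"
    using b1 by (simp add: add_divide_distrib power2_eq_square)
  also have "(norm h)\<^sup>2 / 2 / bracket x \<le> (norm h)\<^sup>2 / 2 / 1"
    using b1 by (intro divide_left_mono) auto
  finally have 1: "bracket (x + h) - bracket x \<le> (x \<bullet> h) / bracket x + (norm h)\<^sup>2 / 2" by simp
  have n: "bracket y = norm (1::real, y)" for y :: 'a by (simp add: bracket_def norm_Pair)
  have "bracket (x + h) \<le> bracket x + norm h"
    using norm_triangle_ineq[of "(1::real, x)" "(0, h)"] by (simp add: n norm_Pair)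
  moreover have "- norm h \<le> (x \<bullet> h) / bracket x"
  proof -
    have "\<bar>x \<bullet> h\<bar> \<le> norm x * norm h" by (rule Cauchy_Schwarz_ineq2)
    also have "\<dots> \<le> bracket x * norm h" by (intro mult_right_mono bracket_ge) auto
    finally show ?thesis using b1 by (simp add: le_divide_eq mult.commute)
  qed
  ultimately show ?thesis using 1 by auto
qed

text \<open>Three variations of the maximum point are used: \<open>(x + h, z - h)\<close> moves only
  the argument of \<open>u\<close>, \<open>(x, z + h)\<close> only that of \<open>v\<close>, and
  \<open>(x + h, z)\<close> moves both by \<open>h\<close> and leaves the quadratic penalty
  unchanged. The first two give the gradients and the paraboloids, the third the comparison of
  increments, with an error from the bracket alone.\<close>

lemma doubling_maximum:
  fixes u v :: "'a::euclidean_space \<Rightarrow> real"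
  assumes u: "GDERIV u x :> p" and v: "GDERIV v (x + z) :> q"
    and \<delta>: "0 < \<delta>" and b: "0 \<le> b" "b \<le> 1 / \<delta>"
    and max: "\<And>x' z'. u x' - v (x' + z') - (norm z')\<^sup>2 / (2 * \<delta>) - b * bracket x'
      \<le> u x - v (x + z) - (norm z)\<^sup>2 / (2 * \<delta>) - b * bracket x"
  shows "q = - (1 / \<delta>) *\<^sub>R z" and "norm (p - q) \<le> b"
    and "u (x + h) - u x - p \<bullet> h \<le> v (x + z + h) - v (x + z) - q \<bullet> h + b * min ((norm h)\<^sup>2 / 2) (2 * norm h)"
    and "u (x + h) - u x - p \<bullet> h \<le> 1 / \<delta> * (norm h)\<^sup>2"
    and "- (1 / \<delta> * (norm h)\<^sup>2) \<le> v (x + z + h) - v (x + z) - q \<bullet> h"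
proof -
  have br: "b * (bracket (x + h) - bracket x) \<le> b * ((x \<bullet> h) / bracket x + min ((norm h)\<^sup>2 / 2) (2 * norm h))" for h
    by (intro mult_left_mono bracket_add_le b)
  have U: "u (x + h) - u x \<le> (- (1 / \<delta>) *\<^sub>R z + (b / bracket x) *\<^sub>R x) \<bullet> h + (1 / (2 * \<delta>) + b / 2) * (norm h)\<^sup>2" for h
  proof -
    have "b * min ((norm h)\<^sup>2 / 2) (2 * norm h) \<le> b * ((norm h)\<^sup>2 / 2)"
      using b by (intro mult_left_mono) auto
    moreover have "(norm (z - h))\<^sup>2 / (2 * \<delta>) = (norm z)\<^sup>2 / (2 * \<delta>) - (1 / \<delta>) * (z \<bullet> h) + 1 / (2 * \<delta>) * (norm h)\<^sup>2"
      using \<delta> by (simp add: power2_norm_eq_inner inner_diff inner_commute field_simps)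
    ultimately show ?thesis
      using max[of "x + h" "z - h"] br[of h] by (simp add: inner_add_left algebra_simps)
  qed
  have V: "(- (1 / \<delta>) *\<^sub>R z) \<bullet> h - 1 / (2 * \<delta>) * (norm h)\<^sup>2 \<le> v (x + z + h) - v (x + z)" for h
  proof -
    have "(norm (z + h))\<^sup>2 / (2 * \<delta>) = (norm z)\<^sup>2 / (2 * \<delta>) + (1 / \<delta>) * (z \<bullet> h) + 1 / (2 * \<delta>) * (norm h)\<^sup>2"
      using \<delta> by (simp add: power2_norm_eq_inner inner_add inner_commute field_simps)
    then show ?thesis using max[of x "z + h"] by (simp add: add.assoc)
  qed
  have p: "p = - (1 / \<delta>) *\<^sub>R z + (b / bracket x) *\<^sub>R x"
    by (rule gderiv_eq_of_quadratic_touch[OF u U])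
  have "GDERIV (\<lambda>x. - v x) (x + z) :> - q" using v by (rule GDERIV_minus)
  then have "- q = (1 / \<delta>) *\<^sub>R z"
    by (rule gderiv_eq_of_quadratic_touch[where C = "1 / (2 * \<delta>)"]) (use V in \<open>simp add: algebra_simps\<close>)
  then show q: "q = - (1 / \<delta>) *\<^sub>R z" by (metis minus_minus scaleR_minus_left)
  have "norm (p - q) = b * (norm x / bracket x)"
    using b bracket_ge(1)[of x] by (simp add: p q)
  also have "\<dots> \<le> b * 1"
    using b bracket_ge[of x] by (intro mult_left_mono) (auto simp: divide_le_eq)
  finally show "norm (p - q) \<le> b" by simp
  show "u (x + h) - u x - p \<bullet> h \<le> v (x + z + h) - v (x + z) - q \<bullet> h + b * min ((norm h)\<^sup>2 / 2) (2 * norm h)"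
    using max[of "x + h" z] br[of h] by (simp add: p q inner_add_left algebra_simps)
  \<comment> \<open>The bound \<open>b \<le> 1 / \<delta>\<close> lets the bracket's curvature fit
    into the opening \<open>1 / \<delta>\<close>.\<close>
  have "(b / 2 + 1 / (2 * \<delta>)) * (norm h)\<^sup>2 \<le> 1 / \<delta> * (norm h)\<^sup>2"
    using b \<delta> by (intro mult_right_mono) (auto simp: field_simps)
  then show "u (x + h) - u x - p \<bullet> h \<le> 1 / \<delta> * (norm h)\<^sup>2"
    using U[of h] unfolding p by (simp add: add.commute)
  have "1 / (2 * \<delta>) * (norm h)\<^sup>2 \<le> 1 / \<delta> * (norm h)\<^sup>2"
    using \<delta> by (intro mult_right_mono) (auto simp: field_simps)
  then show "- (1 / \<delta> * (norm h)\<^sup>2) \<le> v (x + z + h) - v (x + z) - q \<bullet> h"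
    using V[of h] unfolding q by simp
qed

section \<open>Small tails of integrals and maxima on unbounded sets\<close>

lemma nn_integral_tail_small:
  fixes g :: "real \<Rightarrow> ennreal"
  assumes [measurable]: "g \<in> borel_measurable borel" and fin: "(\<integral>\<^sup>+r\<in>{1..}. g r \<partial>lborel) < \<infinity>" and "0 < \<sigma>"
  shows "\<exists>R\<ge>1. (\<integral>\<^sup>+r\<in>{R<..}. g r \<partial>lborel) \<le> ennreal \<sigma>"
proof -
  define M where "M = density lborel (\<lambda>r. g r * indicator {1..} r)"
  have em: "emeasure M A = (\<integral>\<^sup>+r. g r * indicator {1..} r * indicator A r \<partial>lborel)" if "A \<in> sets borel" for A
    using that by (simp add: M_def emeasure_density)
  have "emeasure M {real i<..} \<noteq> \<infinity>" for i
  proof -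
    have "emeasure M {real i<..} \<le> (\<integral>\<^sup>+r\<in>{1..}. g r \<partial>lborel)"
      by (subst em) (auto intro!: nn_integral_mono simp: indicator_def)
    with fin show ?thesis using leD by auto
  qed
  \<comment> \<open>Continuity from above of the finite measure \<open>M\<close> along half-lines
    with empty intersection.\<close>
  then have "(\<lambda>i. emeasure M {real i<..}) \<longlonglongrightarrow> emeasure M (\<Inter>i. {real i<..})"
    by (intro Lim_emeasure_decseq) (auto simp: M_def decseq_def)
  moreover have "(\<Inter>i. {real i<..}) = {}"
  proof -
    have "x \<notin> (\<Inter>i. {real i<..})" for x
      using reals_Archimedean2[of x] by (meson INT_E UNIV_I greaterThan_iff less_asym)
    then show ?thesis by blast
  qed
  ultimately have "\<forall>\<^sub>F i in sequentially. emeasure M {real i<..} < ennreal \<sigma>"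
    using \<open>0 < \<sigma>\<close> by (intro order_tendstoD(2)[where y = 0]) auto
  then obtain i where i: "1 \<le> i" "emeasure M {real i<..} < ennreal \<sigma>"
    using eventually_conj[OF eventually_ge_at_top[of 1]] eventually_happens'[OF sequentially_bot] by blast
  have "(\<integral>\<^sup>+r\<in>{real i<..}. g r \<partial>lborel) = emeasure M {real i<..}"
    using i(1) by (subst em) (auto intro!: nn_integral_cong simp: indicator_def)
  with i show ?thesis by (intro exI[of _ "real i"]) auto
qed

lemma continuous_attains_sup_coercive:
  fixes F :: "'a::{heine_borel, real_normed_vector} \<Rightarrow> real"
  assumes S: "closed S" and F: "continuous_on S F" and p0: "p0 \<in> S"
    and bdd: "\<And>p. p \<in> S \<Longrightarrow> F p0 \<le> F p \<Longrightarrow> norm p \<le> B"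
  shows "\<exists>p\<in>S. \<forall>q\<in>S. F q \<le> F p"
proof -
  have "compact (S \<inter> cball 0 B)" using S by (intro closed_Int_compact) auto
  moreover have in_S: "p0 \<in> S \<inter> cball 0 B" using p0 bdd[of p0] by simp
  moreover have "continuous_on (S \<inter> cball 0 B) F" using F by (rule continuous_on_subset) auto
  ultimately obtain p where p: "p \<in> S \<inter> cball 0 B" "\<And>q. q \<in> S \<inter> cball 0 B \<Longrightarrow> F q \<le> F p"
    using continuous_attains_sup[of "S \<inter> cball 0 B" F] by blast
  have "F q \<le> F p" if "q \<in> S" for q
  proof (cases "F p0 \<le> F q")
    case True
    then show ?thesis using bdd[OF that] p(2) that by auto
  next
    case False
    then show ?thesis using p(2)[OF in_S] by linarith
  qed
  with p(1) show ?thesis by blast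
qed

subsection \<open>Classical solutions\<close>

text \<open>As \<open>grad\<close> is a definite description, a representing vector must be
  exhibited, from the values on the basis, and shown unique.\<close>

lemma GDERIV_grad:
  assumes "u differentiable (at x)"
  shows "GDERIV u x :> grad u x"
proof -
  from assms obtain u' where u': "(u has_derivative u') (at x)"
    by (auto simp: differentiable_def)
  have lin: "linear u'" using u' by (rule has_derivative_linear)
  define D where "D = (\<Sum>i\<in>Basis. u' i *\<^sub>R i)"
  have "u' h = h \<bullet> D" for h
  proof -
    have "u' h = u' (\<Sum>i\<in>Basis. (h \<bullet> i) *\<^sub>R i)" by (simp add: euclidean_representation)
    also have "\<dots> = (\<Sum>i\<in>Basis. (h \<bullet> i) * u' i)"
      by (simp add: linear_sum[OF lin] linear_cmul[OF lin])
    finally show ?thesis by (simp add: D_def inner_sum_right mult.commute)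
  qed
  then have "u' = (\<lambda>h. h \<bullet> D)" by blast
  with u' have D: "GDERIV u x :> D" by (simp add: gderiv_def)
  have "E = D" if "GDERIV u x :> E" for E
  proof -
    have "(\<lambda>h. h \<bullet> E) = (\<lambda>h. h \<bullet> D)"
      using has_derivative_unique that D unfolding gderiv_def by blast
    then have "\<forall>h. h \<bullet> E = h \<bullet> D" by (simp add: fun_eq_iff)
    then show "E = D" by (simp only: vector_eq_ldot)
  qed
  with D show ?thesis unfolding grad_def by (rule theI)
qed

lemma solution_differentiable:
  assumes f: "muskat_classical_solution f" and t: "0 < t"
  shows "(\<lambda>(t, x). f t x) differentiable (at (t, x))"
proof -
  \<comment> \<open>A horizon beyond \<open>t\<close> makes \<open>t\<close> an interior
    time.\<close>
  have "C1_on ({0<..<t + 1} \<times> UNIV) (\<lambda>(t, x). f t x)"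
    using f t by (simp add: muskat_classical_solution_def muskat_classical_solution_on_def)
  moreover have "(t, x) \<in> {0<..<t + 1} \<times> UNIV" using t by simp
  ultimately show ?thesis unfolding C1_on_def differentiable_def by blast
qed

lemma solution_GDERIV:
  assumes "muskat_classical_solution f" "0 < t"
  shows "GDERIV (f t) x :> grad (f t) x"
proof (rule GDERIV_grad)
  have "(\<lambda>(t, x). f t x) differentiable (at ((\<lambda>y. (t, y)) x))"
    using solution_differentiable[OF assms] by simp
  moreover have "(\<lambda>y. (t, y)) differentiable (at x)"
    unfolding differentiable_def by (auto intro!: derivative_eq_intros)
  ultimately show "f t differentiable (at x)"
    using differentiable_chain_at[of "\<lambda>y. (t, y)" x "\<lambda>(t, x). f t x"] by (simp add: o_def)
qed

lemma solution_deriv: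
  assumes "muskat_classical_solution f" "0 < t"
  shows "((\<lambda>s. f s x) has_real_derivative deriv (\<lambda>s. f s x) t) (at t)"
proof -
  have "(\<lambda>(t, x). f t x) differentiable (at ((\<lambda>s. (s, x)) t))"
    using solution_differentiable[OF assms] by simp
  moreover have "(\<lambda>s. (s, x)) differentiable (at t)"
    unfolding differentiable_def by (auto intro!: derivative_eq_intros)
  ultimately have "(\<lambda>s. f s x) differentiable (at t)"
    using differentiable_chain_at[of "\<lambda>s. (s, x)" t "\<lambda>(t, x). f t x"] by (simp add: o_def)
  then have "(\<lambda>s. f s x) field_differentiable (at t)"
    by (auto simp: field_differentiable_def real_differentiable_def)
  then show ?thesis by (simp add: field_differentiable_derivI)
qed

lemma solution_continuous_on:
  fixes f :: "real \<Rightarrow> real ^ 'n \<Rightarrow> real"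
  assumes "muskat_classical_solution f"
  shows "continuous_on ({0<..} \<times> UNIV) (\<lambda>(t, x). f t x)"
proof (rule continuous_at_imp_continuous_on, rule ballI)
  fix p :: "real \<times> (real ^ 'n)" assume "p \<in> {0<..} \<times> UNIV"
  then show "isCont (\<lambda>(t, x). f t x) p"
    using solution_differentiable[OF assms] by (cases p) (auto intro: differentiable_imp_continuous_within)
qed

lemma solution_pv:
  assumes "muskat_classical_solution f" "0 < t"
  shows "has_pv_integral (muskat_integrand (f t) x) (deriv (\<lambda>s. f s x) t) x"
proof -
  have "muskat_classical_solution_on (t + 1) f"
    using assms by (simp add: muskat_classical_solution_def)
  then show ?thesis using assms(2) by (simp add: muskat_classical_solution_on_def)
qed

lemma solution_grad_le:
  assumes "grad_sup_norm f \<le> ereal L" "0 < t"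
  shows "norm (grad (f t) x) \<le> L"
proof -
  have "ereal (norm (grad (f t) x)) \<le> grad_sup_norm f"
    unfolding grad_sup_norm_def using assms(2) by (intro SUP_upper2[of "(t, x)"]) auto
  with assms(1) have "ereal (norm (grad (f t) x)) \<le> ereal L" by (rule order_trans[rotated])
  then show ?thesis by simp
qed

lemma solution_Lipschitz:
  assumes f: "muskat_classical_solution f" and L: "grad_sup_norm f \<le> ereal L" and t: "0 < t"
  shows "\<bar>f t (x + h) - f t x\<bar> \<le> L * norm h"
proof -
  have L0: "0 \<le> L" using solution_grad_le[OF L t] norm_ge_zero order_trans by blast
  have "norm (f t (x + h) - f t x) \<le> L * norm (x + h - x)"
  proof (rule differentiable_bound[where S = UNIV and f' = "\<lambda>y h. h \<bullet> grad (f t) y"])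
    show "(f t has_derivative (\<lambda>h. h \<bullet> grad (f t) y)) (at y within UNIV)" for y
      using solution_GDERIV[OF f t, of y] by (simp add: gderiv_def)
    show "onorm (\<lambda>h. h \<bullet> grad (f t) y) \<le> L" for y
    proof (rule onorm_bound[OF L0])
      fix h
      have "\<bar>h \<bullet> grad (f t) y\<bar> \<le> norm h * norm (grad (f t) y)" by (rule Cauchy_Schwarz_ineq2)
      also have "\<dots> \<le> norm h * L" by (intro mult_left_mono solution_grad_le[OF L t]) auto
      finally show "norm (h \<bullet> grad (f t) y) \<le> L * norm h" by (simp add: mult.commute)
    qed
  qed auto
  then show ?thesis by simp
qed

section \<open>Growth moduli and sublinear growth\<close>

lemma nn_integral_dilate_inverse_square:
  fixes \<Omega> :: "real \<Rightarrow> real"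
  assumes [measurable]: "\<Omega> \<in> borel_measurable borel" and c: "1 \<le> c"
  shows "(\<integral>\<^sup>+r\<in>{1..}. ennreal (\<Omega> (c * r) / r\<^sup>2) \<partial>lborel) \<le> ennreal c * (\<integral>\<^sup>+R\<in>{1..}. ennreal (\<Omega> R / R\<^sup>2) \<partial>lborel)"
proof -
  have "(\<integral>\<^sup>+R\<in>{1..}. ennreal (\<Omega> R / R\<^sup>2) \<partial>lborel) =
      ennreal c * (\<integral>\<^sup>+r. ennreal (\<Omega> (c * r) / (c * r)\<^sup>2) * indicator {1..} (c * r) \<partial>lborel)"
    using c nn_integral_real_affine[of "\<lambda>R. ennreal (\<Omega> R / R\<^sup>2) * indicator {1..} R" c 0] by simp
  then have "ennreal c * (\<integral>\<^sup>+R\<in>{1..}. ennreal (\<Omega> R / R\<^sup>2) \<partial>lborel) =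
      (\<integral>\<^sup>+r. ennreal c * (ennreal c * (ennreal (\<Omega> (c * r) / (c * r)\<^sup>2) * indicator {1..} (c * r))) \<partial>lborel)"
    by (simp add: nn_integral_cmult)
  \<comment> \<open>The substitution \<open>R = c * r\<close> leaves an integral over
    \<open>c * r \<ge> 1\<close>, a range that contains \<open>r \<ge> 1\<close>; hence an
    inequality.\<close>
  also have "\<dots> \<ge> (\<integral>\<^sup>+r\<in>{1..}. ennreal (\<Omega> (c * r) / r\<^sup>2) \<partial>lborel)"
  proof (rule nn_integral_mono)
    fix r :: real
    show "ennreal (\<Omega> (c * r) / r\<^sup>2) * indicator {1..} r \<le>
        ennreal c * (ennreal c * (ennreal (\<Omega> (c * r) / (c * r)\<^sup>2) * indicator {1..} (c * r)))"
    proof (cases "1 \<le> r")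
      case True
      then have "1 \<le> c * r" using c mult_mono[of 1 c 1 r] by simp
      moreover have "c * (c * (\<Omega> (c * r) / (c * r)\<^sup>2)) = \<Omega> (c * r) / r\<^sup>2"
        using c by (simp add: power_mult_distrib power2_eq_square)
      ultimately show ?thesis using True c by (simp add: ennreal_mult'[symmetric])
    qed simp
  qed
  finally show ?thesis .
qed

text \<open>The moduli are uniform only over compact sets of base points, whereas the doubling
  maximum may lie far out. Only the base point 0 is used, and the triangle inequality passes to
  every \<open>x\<close> with norm at most \<open>r\<close>.\<close>

lemma solution_growth_modulus:
  assumes f: "muskat_classical_solution f" and t: "0 < t\<^sub>1"
  shows "\<exists>W. W \<in> borel_measurable borel \<and> (\<forall>r. 0 \<le> W r) \<and> (\<integral>\<^sup>+r\<in>{1..}. ennreal (W r / r\<^sup>2) \<partial>lborel) < \<infinity> \<and>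
    (\<forall>t x h r. t\<^sub>1 \<le> t \<longrightarrow> t \<le> T \<longrightarrow> 0 < r \<longrightarrow> norm x \<le> r \<longrightarrow> norm h \<le> r \<longrightarrow> \<bar>f t (x + h) - f t x\<bar> \<le> W r)"
proof (cases "t\<^sub>1 \<le> T")
  case False
  then show ?thesis by (intro exI[of _ "\<lambda>_. 0"]) auto
next
  case True
  let ?K = "{t\<^sub>1..T} \<times> {0}"
  have "muskat_classical_solution_on (T + 1) f"
    using f t True by (simp add: muskat_classical_solution_def)
  moreover have "compact ?K \<and> ?K \<subseteq> {0<..<T + 1} \<times> UNIV"
    using t by (auto intro!: compact_Times)
  ultimately have "muskat_moduli f ?K" unfolding muskat_classical_solution_on_def by blast
  then obtain \<Omega> :: "real \<Rightarrow> real" where sm: "smooth_halfline \<Omega>" and pos: "\<And>r. 0 \<le> r \<Longrightarrow> 0 \<le> \<Omega> r"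
    and bd: "\<And>t R h. t\<^sub>1 \<le> t \<Longrightarrow> t \<le> T \<Longrightarrow> 0 \<le> R \<Longrightarrow> norm h < R \<Longrightarrow> \<bar>f t h - f t 0\<bar> \<le> \<Omega> R"
    and fin: "(\<integral>\<^sup>+R\<in>{1..}. ennreal (\<Omega> R / R\<^sup>2) \<partial>lborel) < \<infinity>"
    unfolding muskat_moduli_def by (force simp: ennreal_add_less_top)
  have cont: "continuous_on {0..} \<Omega>"
  proof -
    obtain D where D: "\<And>r. 0 \<le> r \<Longrightarrow> D (0::nat) r = \<Omega> r"
      "\<And>k r. 0 \<le> r \<Longrightarrow> (D k has_real_derivative D (Suc k) r) (at r within {0..})"
      using sm unfolding smooth_halfline_def by blast
    have "continuous_on {0..} (D 0)"
      using D(2)[of _ 0] by (intro DERIV_continuous_on) auto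
    then show ?thesis by (rule continuous_on_eq) (simp add: D(1))
  qed
  \<comment> \<open>Extension by zero: \<open>\<Omega>\<close> is controlled only on the closed
    half-line, but measurability is needed on the whole line.\<close>
  define \<Omega>' where "\<Omega>' r = indicator {0..} r * \<Omega> r" for r :: real
  have m[measurable]: "\<Omega>' \<in> borel_measurable borel"
    using borel_measurable_continuous_on_indicator[OF _ cont] by (simp add: \<Omega>'_def[abs_def])
  \<comment> \<open>The factor 2 counts the increments from 0 to \<open>x + h\<close> and to
    \<open>x\<close>. Radius \<open>3 * r\<close> strictly exceeds \<open>2 * r\<close>, as the
    modulus refers to open balls.\<close>
  define W where "W r = 2 * \<Omega>' (3 * r)" for r
  have "(\<integral>\<^sup>+r\<in>{1..}. ennreal (W r / r\<^sup>2) \<partial>lborel) = (\<integral>\<^sup>+r. ennreal 2 * (ennreal (\<Omega>' (3 * r) / r\<^sup>2) * indicator {1..} r) \<partial>lborel)"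
    unfolding W_def by (intro nn_integral_cong) (auto simp: indicator_def ennreal_mult'[symmetric] simp del: ennreal_numeral)
  also have "\<dots> = ennreal 2 * (\<integral>\<^sup>+r\<in>{1..}. ennreal (\<Omega>' (3 * r) / r\<^sup>2) \<partial>lborel)"
    by (subst nn_integral_cmult) auto
  also have "\<dots> \<le> ennreal 2 * (ennreal 3 * (\<integral>\<^sup>+R\<in>{1..}. ennreal (\<Omega>' R / R\<^sup>2) \<partial>lborel))"
    by (intro mult_left_mono nn_integral_dilate_inverse_square m) auto
  also have "(\<integral>\<^sup>+R\<in>{1..}. ennreal (\<Omega>' R / R\<^sup>2) \<partial>lborel) = (\<integral>\<^sup>+R\<in>{1..}. ennreal (\<Omega> R / R\<^sup>2) \<partial>lborel)"
    by (intro nn_integral_cong) (auto simp: \<Omega>'_def indicator_def)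
  also have "ennreal 2 * (ennreal 3 * \<dots>) < \<infinity>"
    using fin by (simp add: ennreal_mult_less_top)
  finally have "(\<integral>\<^sup>+r\<in>{1..}. ennreal (W r / r\<^sup>2) \<partial>lborel) < \<infinity>" .
  moreover have "W \<in> borel_measurable borel" unfolding W_def by measurable
  moreover have "0 \<le> W r" for r using pos by (auto simp: W_def \<Omega>'_def indicator_def)
  moreover have "\<bar>f t (x + h) - f t x\<bar> \<le> W r"
    if "t\<^sub>1 \<le> t" "t \<le> T" "0 < r" "norm x \<le> r" "norm h \<le> r" for t x h r
  proof -
    have "norm (x + h) < 3 * r" "norm x < 3 * r"
      using that norm_triangle_ineq[of x h] by linarith+
    then have "\<bar>f t (x + h) - f t 0\<bar> \<le> \<Omega> (3 * r)" "\<bar>f t x - f t 0\<bar> \<le> \<Omega> (3 * r)"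
      using that by (auto intro!: bd)
    then show ?thesis using that by (auto simp: W_def \<Omega>'_def)
  qed
  ultimately show ?thesis by blast
qed

text \<open>A value \<open>u i x\<close> bounds \<open>W s\<close> from below for every
  \<open>s \<ge> norm x\<close>. A large value at radius \<open>r\<close> would thus contribute too
  much to the tail integral over \<open>{r<..2 * r}\<close>; monotonicity of \<open>W\<close> is not
  assumed.\<close>

lemma sublinear_of_growth_modulus:
  fixes W :: "real \<Rightarrow> real" and u :: "'b \<Rightarrow> 'a::real_normed_vector \<Rightarrow> real"
  assumes W[measurable]: "W \<in> borel_measurable borel" and fin: "(\<integral>\<^sup>+r\<in>{1..}. ennreal (W r / r\<^sup>2) \<partial>lborel) < \<infinity>"
    and u: "\<And>i x r. i \<in> S \<Longrightarrow> 0 < r \<Longrightarrow> norm x \<le> r \<Longrightarrow> u i x \<le> W r" and \<sigma>: "0 < \<sigma>"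
  shows "\<exists>C. \<forall>i\<in>S. \<forall>x. u i x \<le> \<sigma> * norm x + C"
proof -
  obtain R where R: "1 \<le> R" "(\<integral>\<^sup>+r\<in>{R<..}. ennreal (W r / r\<^sup>2) \<partial>lborel) \<le> ennreal (\<sigma> / 4)"
    using nn_integral_tail_small[OF _ fin, of "\<sigma> / 4"] \<sigma> by auto
  have "u i x \<le> \<sigma> * norm x + \<bar>W R\<bar>" if i: "i \<in> S" for i x
  proof (cases "norm x \<le> R")
    case True
    then have "u i x \<le> W R" using R i by (intro u) auto
    moreover have "0 \<le> \<sigma> * norm x" using \<sigma> by simp
    ultimately show ?thesis by linarith
  next
    case False
    define r where "r = norm x"
    have r: "R < r" "0 < r" using False R by (auto simp: r_def)
    show ?thesis
    proof (cases "u i x \<le> 0")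
      case True
      moreover have "0 \<le> \<sigma> * norm x" using \<sigma> by simp
      ultimately show ?thesis by linarith
    next
      case neg: False
      \<comment> \<open>The interval has length \<open>r\<close>, and \<open>1 / s\<^sup>2\<close>
        is at least \<open>1 / (2 * r)\<^sup>2\<close> on it. This fixes the tail bound
        \<open>\<sigma> / 4\<close> above.\<close>
      have "ennreal (u i x / (4 * r)) = ennreal (u i x / (2 * r)\<^sup>2) * emeasure lborel {r<..2 * r}"
        using r neg by (simp add: ennreal_mult'[symmetric] power2_eq_square)
      also have "\<dots> = (\<integral>\<^sup>+s\<in>{r<..2 * r}. ennreal (u i x / (2 * r)\<^sup>2) \<partial>lborel)"
        by (simp add: nn_integral_cmult_indicator)
      also have "\<dots> \<le> (\<integral>\<^sup>+s\<in>{R<..}. ennreal (W s / s\<^sup>2) \<partial>lborel)"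
      proof (rule nn_integral_mono)
        fix s :: real
        show "ennreal (u i x / (2 * r)\<^sup>2) * indicator {r<..2 * r} s \<le> ennreal (W s / s\<^sup>2) * indicator {R<..} s"
        proof (cases "s \<in> {r<..2 * r}")
          case True
          then have "u i x \<le> W s" using i r by (intro u) (auto simp: r_def)
          then have "u i x / (2 * r)\<^sup>2 \<le> W s / s\<^sup>2"
            using True r neg by (intro frac_le power_mono) auto
          then show ?thesis using True r by (auto intro!: ennreal_leI)
        qed simp
      qed
      also have "\<dots> \<le> ennreal (\<sigma> / 4)" by (rule R)
      finally have "u i x / (4 * r) \<le> \<sigma> / 4" using \<sigma> by (subst (asm) ennreal_le_iff) auto
      then have "u i x \<le> \<sigma> * r" using r by (simp add: field_simps)
      then show ?thesis by (simp add: r_def)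
    qed
  qed
  then show ?thesis by blast
qed

section \<open>Transfer of the initial order to a positive time\<close>

lemma solution_initial:
  assumes f: "muskat_classical_solution f" and "0 < \<mu>"
  shows "\<forall>\<^sub>F t in at_right 0. AE x in lebesgue. \<bar>f t x - f 0 x\<bar> \<le> \<mu>"
proof -
  have "((\<lambda>\<epsilon>. Linf_norm (\<lambda>x. f \<epsilon> x - f 0 x)) \<longlongrightarrow> 0) (at_right 0)"
    using f by (auto simp: muskat_classical_solution_def muskat_classical_solution_on_def intro: zero_less_one)
  then have "\<forall>\<^sub>F t in at_right 0. Linf_norm (\<lambda>x. f t x - f 0 x) < ereal \<mu>"
    using \<open>0 < \<mu>\<close> by (intro order_tendstoD(2)) auto
  then show ?thesis
  proof eventually_elim
    case (elim t)
    have "AE x in lebesgue. ereal \<bar>f t x - f 0 x\<bar> \<le> Linf_norm (\<lambda>x. f t x - f 0 x)"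
      unfolding Linf_norm_def by (rule esssup_AE)
    then show ?case
    proof eventually_elim
      case (elim x)
      also note \<open>Linf_norm (\<lambda>x. f t x - f 0 x) < ereal \<mu>\<close>
      finally show ?case by simp
    qed
  qed
qed

lemma AE_le_imp_le:
  fixes u :: "'a::euclidean_space \<Rightarrow> real"
  assumes "continuous_on UNIV u" and "AE x in lebesgue. u x \<le> c"
  shows "u x \<le> c"
proof (rule ccontr)
  assume "\<not> u x \<le> c"
  let ?A = "{x. c < u x}"
  have "open ?A" using assms(1) by (intro open_Collect_less) auto
  moreover have "?A \<noteq> {}" using \<open>\<not> u x \<le> c\<close> by (auto simp: not_le)
  moreover have "negligible ?A"
  proof (rule AE_E3[OF assms(2)])
    fix N assume "\<And>x. x \<in> space lebesgue - N \<Longrightarrow> u x \<le> c" "N \<in> null_sets lebesgue"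
    then have "negligible N" "?A \<subseteq> N" by (force simp: negligible_iff_null_sets)+
    then show "negligible ?A" by (rule negligible_subset)
  qed
  ultimately show False using open_not_negligible by blast
qed

text \<open>Convergence at time 0 is in essential supremum, so the order first passes to time
  \<open>t\<close> almost everywhere. Continuity at the positive time \<open>t\<close> then gives it
  at every point.\<close>

lemma solutions_initial_order:
  fixes f g :: "real \<Rightarrow> real ^ 'n \<Rightarrow> real"
  assumes f: "muskat_classical_solution f" and g: "muskat_classical_solution g"
    and le: "\<And>x. f 0 x \<le> g 0 x" and "0 < \<mu>" "0 < T"
  shows "\<exists>t. 0 < t \<and> t < T \<and> (\<forall>x. f t x \<le> g t x + \<mu>)"
proof -
  have "\<forall>\<^sub>F t in at_right 0. (AE x in lebesgue. \<bar>f t x - f 0 x\<bar> \<le> \<mu> / 2) \<and>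
      (AE x in lebesgue. \<bar>g t x - g 0 x\<bar> \<le> \<mu> / 2) \<and> 0 < t \<and> t < T"
    using assms by (intro eventually_conj solution_initial) (auto simp: eventually_at_right_field)
  then obtain t where t: "AE x in lebesgue. \<bar>f t x - f 0 x\<bar> \<le> \<mu> / 2"
      "AE x in lebesgue. \<bar>g t x - g 0 x\<bar> \<le> \<mu> / 2" "0 < t" "t < T"
    using eventually_happens'[OF trivial_limit_at_right_real] by blast
  have "continuous_on UNIV (f t)" "continuous_on UNIV (g t)"
    using solution_GDERIV[OF f t(3)] solution_GDERIV[OF g t(3)]
    by (auto simp: gderiv_def intro!: has_derivative_continuous_on)
  then have "continuous_on UNIV (\<lambda>x. f t x - g t x)" by (intro continuous_intros)
  moreover have "AE x in lebesgue. f t x - g t x \<le> \<mu>"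
    using t(1,2)
  proof eventually_elim
    case (elim x)
    then show ?case using le[of x] by linarith
  qed
  ultimately have "f t x - g t x \<le> \<mu>" for x by (rule AE_le_imp_le)
  then show ?thesis using t by (intro exI[of _ t]) (auto simp: algebra_simps)
qed

subsection \<open>The comparison principle\<close>

text \<open>Sublinear growth makes the bracket penalty dominate in \<open>x\<close>, and the
  quadratic term beats the Lipschitz growth of \<open>g\<close> in \<open>z\<close>. The set where
  \<open>F\<close> is at least its value at \<open>p\<close> is therefore bounded.\<close>

lemma doubling_coercive:
  fixes f g :: "real \<Rightarrow> real ^ 'n \<Rightarrow> real" and \<beta> :: "real \<Rightarrow> real"
  assumes f: "muskat_classical_solution f" and g: "muskat_classical_solution g"
    and L: "grad_sup_norm g \<le> ereal 1" and t\<^sub>1: "0 < t\<^sub>1" "t\<^sub>1 \<le> T"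
    and \<delta>: "0 < \<delta>" "\<delta> \<le> 1" and \<epsilon>: "0 < \<epsilon>"
    and \<beta>: "continuous_on {t\<^sub>1..T} \<beta>" "\<And>t. t \<in> {t\<^sub>1..T} \<Longrightarrow> \<epsilon> \<le> \<beta> t" and \<kappa>: "0 \<le> \<kappa>"
    and F: "\<And>t x z. F (t, x, z) = f t x - g t (x + z) - (norm z)\<^sup>2 / (2 * \<delta>) - \<beta> t * bracket x - \<kappa> * (t - t\<^sub>1)"
    and p: "p \<in> {t\<^sub>1..T} \<times> UNIV \<times> UNIV" "0 \<le> F p"
  shows "\<exists>p\<in>{t\<^sub>1..T} \<times> UNIV \<times> UNIV. \<forall>q\<in>{t\<^sub>1..T} \<times> UNIV \<times> UNIV. F q \<le> F p"
proof -
  let ?S = "{t\<^sub>1..T} \<times> (UNIV :: (real ^ 'n) set) \<times> (UNIV :: (real ^ 'n) set)"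
  have contf: "continuous_on S (\<lambda>p. f (\<tau> p) (\<xi> p))"
    if "continuous_on S \<tau>" "continuous_on S \<xi>" "\<And>p. p \<in> S \<Longrightarrow> 0 < \<tau> p"
      and f: "muskat_classical_solution f"
    for S :: "'b::topological_space set" and \<tau> \<xi> and f :: "real \<Rightarrow> real ^ 'n \<Rightarrow> real"
    using continuous_on_compose2[OF solution_continuous_on[OF f], of S "\<lambda>p. (\<tau> p, \<xi> p)"] that
    by (simp add: continuous_on_Pair image_subset_iff)
  have pos: "0 < t" if "t \<in> {t\<^sub>1..T}" for t using t\<^sub>1 that by auto
  have pos': "0 < fst p" if "p \<in> ?S" for p using that by (auto intro: pos)
  have 1: "continuous_on ?S (\<lambda>p. f (fst p) (fst (snd p)))"
    by (rule contf[OF _ _ pos' f]) (auto intro!: continuous_intros)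
  have 2: "continuous_on ?S (\<lambda>p. g (fst p) (fst (snd p) + snd (snd p)))"
    by (rule contf[OF _ _ pos' g]) (auto intro!: continuous_intros)
  have 3: "continuous_on ?S (\<lambda>p. \<beta> (fst p))"
    by (rule continuous_on_compose2[OF \<beta>(1)]) (auto intro!: continuous_intros)
  have 4: "continuous_on ?S (\<lambda>p. bracket (fst (snd p)))"
    by (rule continuous_on_compose2[OF continuous_on_bracket[of UNIV]]) (auto intro!: continuous_intros)
  have "continuous_on ?S (\<lambda>p. f (fst p) (fst (snd p)) - g (fst p) (fst (snd p) + snd (snd p)) -
      (norm (snd (snd p)))\<^sup>2 / (2 * \<delta>) - \<beta> (fst p) * bracket (fst (snd p)) - \<kappa> * (fst p - t\<^sub>1))"
    using \<delta> by (intro 1 2 3 4 continuous_on_diff continuous_on_mult continuous_on_divide continuous_on_power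
        continuous_on_norm continuous_on_const continuous_on_fst continuous_on_snd continuous_on_id) auto
  then have contF: "continuous_on ?S F"
    by (rule continuous_on_eq) (auto simp: F)
  obtain Wf Wg where W: "Wf \<in> borel_measurable borel" "Wg \<in> borel_measurable borel"
      "(\<integral>\<^sup>+r\<in>{1..}. ennreal (Wf r / r\<^sup>2) \<partial>lborel) < \<infinity>" "(\<integral>\<^sup>+r\<in>{1..}. ennreal (Wg r / r\<^sup>2) \<partial>lborel) < \<infinity>"
    and Wf: "\<And>t h r. t \<in> {t\<^sub>1..T} \<Longrightarrow> 0 < r \<Longrightarrow> norm h \<le> r \<Longrightarrow> \<bar>f t h - f t 0\<bar> \<le> Wf r"
    and Wg: "\<And>t h r. t \<in> {t\<^sub>1..T} \<Longrightarrow> 0 < r \<Longrightarrow> norm h \<le> r \<Longrightarrow> \<bar>g t h - g t 0\<bar> \<le> Wg r"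
    using solution_growth_modulus[OF f t\<^sub>1(1), of T] solution_growth_modulus[OF g t\<^sub>1(1), of T]
    by (metis (no_types, lifting) add_0 atLeastAtMost_iff norm_zero less_imp_le)
  \<comment> \<open>Rate \<open>\<epsilon> / 4\<close> for each of \<open>f\<close> and
    \<open>g\<close> uses half of the penalty \<open>\<epsilon> * norm x\<close>.\<close>
  have e4: "0 < \<epsilon> / 4" using \<epsilon> by simp
  obtain Cf where Cf: "\<And>t x. t \<in> {t\<^sub>1..T} \<Longrightarrow> \<bar>f t x - f t 0\<bar> \<le> \<epsilon> / 4 * norm x + Cf"
    using sublinear_of_growth_modulus[OF W(1,3), of "{t\<^sub>1..T}" "\<lambda>t x. \<bar>f t x - f t 0\<bar>", OF Wf e4] by blast
  obtain Cg where Cg: "\<And>t x. t \<in> {t\<^sub>1..T} \<Longrightarrow> \<bar>g t x - g t 0\<bar> \<le> \<epsilon> / 4 * norm x + Cg"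
    using sublinear_of_growth_modulus[OF W(2,4), of "{t\<^sub>1..T}" "\<lambda>t x. \<bar>g t x - g t 0\<bar>", OF Wg e4] by blast
  have "continuous_on {t\<^sub>1..T} (\<lambda>t. f t 0 - g t 0)"
    by (intro continuous_on_diff contf[OF _ _ _ f] contf[OF _ _ _ g] continuous_on_id continuous_on_const pos)
  then have "compact ((\<lambda>t. f t 0 - g t 0) ` {t\<^sub>1..T})" by (intro compact_continuous_image) auto
  then obtain C0 where C0: "\<And>t. t \<in> {t\<^sub>1..T} \<Longrightarrow> f t 0 - g t 0 \<le> C0"
    using compact_imp_bounded bounded_real by (metis (no_types, lifting) abs_le_D1 imageI)
  \<comment> \<open>The summand 2 is the cost of replacing the quadratic term by
    \<open>2 * norm z - 2\<close>, of which one \<open>norm z\<close> pays for the variation of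
    \<open>g\<close>.\<close>
  define Q where "Q = Cf + Cg + C0 + 2"
  have upper: "F (t, x, z) \<le> Q - \<epsilon> / 2 * norm x - norm z" if t: "t \<in> {t\<^sub>1..T}" for t x z
  proof -
    have "0 < t" by (rule pos[OF t])
    have "g t x - g t (x + z) \<le> norm z"
      using solution_Lipschitz[OF g L \<open>0 < t\<close>, of x z] by (simp add: abs_le_iff)
    moreover have "f t x - f t 0 \<le> \<epsilon> / 4 * norm x + Cf" "g t 0 - g t x \<le> \<epsilon> / 4 * norm x + Cg"
      using Cf[OF t, of x] Cg[OF t, of x] by linarith+
    moreover have "f t 0 - g t 0 \<le> C0" by (rule C0[OF t])
    moreover have "\<epsilon> * norm x \<le> \<beta> t * bracket x"
      using \<epsilon> \<beta>(2)[OF t] by (intro mult_mono bracket_ge) auto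
    moreover have "0 \<le> \<kappa> * (t - t\<^sub>1)" using \<kappa> t by simp
    moreover have "2 * norm z - 2 \<le> (norm z)\<^sup>2 / (2 * \<delta>)"
    proof -
      have "0 \<le> (norm z - 2)\<^sup>2" by simp
      then have "2 * norm z - 2 \<le> (norm z)\<^sup>2 / 2" by (simp add: power2_diff)
      also have "\<dots> \<le> (norm z)\<^sup>2 / (2 * \<delta>)" using \<delta> by (intro divide_left_mono) auto
      finally show ?thesis .
    qed
    ultimately show ?thesis unfolding F Q_def by simp
  qed
  show ?thesis
  proof (rule continuous_attains_sup_coercive[OF _ contF p(1)])
    show "closed ?S" by (intro closed_Times) auto
    fix q assume q: "q \<in> ?S" "F p \<le> F q"
    obtain t x z where q': "q = (t, x, z)" by (metis prod_cases3)
    then have t: "t \<in> {t\<^sub>1..T}" using q by auto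
    have *: "\<epsilon> / 2 * norm x + norm z \<le> Q" using upper[OF t, of x z] q p(2) by (simp add: q')
    have nn: "0 \<le> \<epsilon> / 2 * norm x" using \<epsilon> by simp
    then have "norm z \<le> Q" using * by linarith
    moreover have "norm x \<le> 2 * Q / \<epsilon>"
    proof -
      have "\<epsilon> * norm x \<le> 2 * Q" using * norm_ge_zero[of z] by linarith
      then show ?thesis using \<epsilon> by (simp add: le_divide_eq mult.commute)
    qed
    moreover have "norm t \<le> T" using t t\<^sub>1 by auto
    moreover have "norm q \<le> norm t + (norm x + norm z)"
      unfolding q' using norm_Pair_le[of t "(x, z)"] norm_Pair_le[of x z] by linarith
    ultimately show "norm q \<le> T + (2 * Q / \<epsilon> + Q)" by linarith
  qed
qed

text \<open>The equation turns the time derivatives into principal values. At the maximum,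
  \<open>doubling_maximum\<close> supplies the gradient and touching conditions of the nonlocal
  comparison.\<close>

lemma solution_speed_difference_at_doubling_maximum:
  fixes f g :: "real \<Rightarrow> real ^ 'n \<Rightarrow> real"
  defines "m \<equiv> real CARD('n) + 1"
  defines "c \<equiv> real CARD('n) * unit_ball_vol (real CARD('n))"
  assumes f: "muskat_classical_solution f" and g: "muskat_classical_solution g"
    and L: "0 \<le> L" "L \<le> 1" "grad_sup_norm f \<le> ereal L" "grad_sup_norm g \<le> ereal L"
    and L': "L + 3 * b \<le> L'" "(2 * m - 1) * L'\<^sup>2 \<le> 1"
    and t: "0 < t" and \<delta>: "0 < \<delta>" "\<delta> \<le> 1" and b: "0 \<le> b" "b \<le> 1 / \<delta>"
    and max: "\<And>x' z'. f t x' - g t (x' + z') - (norm z')\<^sup>2 / (2 * \<delta>) - b * bracket x'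
      \<le> f t x - g t (x + z) - (norm z)\<^sup>2 / (2 * \<delta>) - b * bracket x"
    and W: "W \<in> borel_measurable borel" "\<And>r. 0 \<le> W r"
    and fgW: "\<And>x y h r. 0 < r \<Longrightarrow> norm x \<le> r \<Longrightarrow> norm y \<le> r \<Longrightarrow> norm h \<le> r \<Longrightarrow>
      \<bar>f t (x + h) - f t x\<bar> + \<bar>g t (y + h) - g t y\<bar> \<le> W r"
    and tau: "0 \<le> \<tau>" "(\<integral>\<^sup>+r\<in>{R..}. ennreal (W r / r\<^sup>2) \<partial>lborel) \<le> ennreal \<tau>" and R: "0 < R"
  shows "deriv (\<lambda>s. f s x) t - deriv (\<lambda>s. g s (x + z)) t \<le>
    c * (b * (3 * m * (1 / \<delta>) + 1 / 2) * (bracket x + 1 + R) + (1 + m * L) * \<tau>)"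
proof -
  note D = doubling_maximum[OF solution_GDERIV[OF f t] solution_GDERIV[OF g t] \<delta>(1) b max]
  note glip = solution_grad_le[OF L(3) t] solution_grad_le[OF L(4) t]
  \<comment> \<open>This splitting radius exceeds the norms of both base points, so the growth
    modulus applies beyond it. The summand 1 allows for \<open>norm z\<close>, which is \<delta>
    times a gradient norm and so at most 1.\<close>
  define \<rho> where "\<rho> = bracket x + 1 + R"
  have "norm z = \<delta> * norm (grad (g t) (x + z))" using \<delta> by (simp add: D(1))
  also have "\<dots> \<le> 1 * 1" using \<delta> glip(2)[of "x + z"] L by (intro mult_mono) auto
  finally have z: "norm z \<le> 1" by simp
  have x: "norm x \<le> \<rho>" "norm (x + z) \<le> \<rho>" "0 < \<rho>" "R \<le> \<rho>"
    using bracket_ge[of x] R z norm_triangle_ineq[of x z] by (auto simp: \<rho>_def)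
  show ?thesis
    unfolding m_def c_def \<rho>_def[symmetric]
  proof (rule muskat_nonlocal_comparison[OF solution_pv[OF f t] solution_pv[OF g t] L(1) L'[unfolded m_def] b(1)
        solution_Lipschitz[OF f L(3) t] solution_Lipschitz[OF g L(4) t] glip D(2,3) _ D(4,5) x(3) W _ tau(1)])
    show "0 \<le> 1 / \<delta>" using \<delta> by simp
    show "\<bar>f t (x + h) - f t x\<bar> + \<bar>g t (x + z + h) - g t (x + z)\<bar> \<le> W (norm h)" if "\<rho> < norm h" for h
      using that x by (intro fgW) auto
    have "(\<integral>\<^sup>+r\<in>{\<rho><..}. ennreal (W r / r\<^sup>2) \<partial>lborel) \<le> (\<integral>\<^sup>+r\<in>{R..}. ennreal (W r / r\<^sup>2) \<partial>lborel)"
      using x by (intro nn_integral_mono) (auto simp: indicator_def)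
    with tau(2) show "(\<integral>\<^sup>+r\<in>{\<rho><..}. ennreal (W r / r\<^sup>2) \<partial>lborel) \<le> ennreal \<tau>" by simp
  qed
qed

lemma muskat_comparison:
  fixes f g :: "real \<Rightarrow> real ^ 'n \<Rightarrow> real"
  assumes f: "muskat_classical_solution f" and g: "muskat_classical_solution g"
    and L: "0 \<le> L" "L < L'" "grad_sup_norm f \<le> ereal L" "grad_sup_norm g \<le> ereal L"
    and L': "(2 * (real CARD('n) + 1) - 1) * L'\<^sup>2 \<le> 1"
    and init: "\<And>x. f 0 x \<le> g 0 x" and T: "0 < T"
  shows "f T x\<^sub>T \<le> g T x\<^sub>T"
proof (rule ccontr)
  assume "\<not> f T x\<^sub>T \<le> g T x\<^sub>T"
  \<comment> \<open>Of the excess \<open>4 * \<mu>\<close> at the final time, the time slope costs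
    \<mu> and the penalty at most \<open>\<mu> / 2\<close>, which leaves
    \<open>5 / 2 * \<mu>\<close>. At \<open>t\<^sub>1\<close> the initial error and the doubling
    error give at most \<open>2 * \<mu>\<close>, so the maximum lies after
    \<open>t\<^sub>1\<close>.\<close>
  define \<mu> where "\<mu> = (f T x\<^sub>T - g T x\<^sub>T) / 4"
  have \<mu>: "0 < \<mu>" "f T x\<^sub>T - g T x\<^sub>T = 4 * \<mu>" using \<open>\<not> f T x\<^sub>T \<le> g T x\<^sub>T\<close> by (auto simp: \<mu>_def)
  obtain t\<^sub>1 where t\<^sub>1: "0 < t\<^sub>1" "t\<^sub>1 < T" and init1: "\<And>x. f t\<^sub>1 x \<le> g t\<^sub>1 x + \<mu>"
    using solutions_initial_order[OF f g init \<mu>(1) T] by blast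
  define m where "m = real CARD('n) + 1"
  define c where "c = real CARD('n) * unit_ball_vol (real CARD('n))"
  have m: "1 \<le> m" and c: "0 \<le> c" by (auto simp: m_def c_def)
  have L1: "L \<le> 1"
  proof -
    have "1 * L'\<^sup>2 \<le> (2 * m - 1) * L'\<^sup>2" using m by (intro mult_right_mono) auto
    then have "L'\<^sup>2 \<le> 1" using L' by (simp add: m_def)
    then show ?thesis using L abs_square_le_1[of L'] by linarith
  qed
  \<comment> \<open>The doubling error \<open>norm z - (norm z)\<^sup>2 / (2 * \<delta>)\<close> is
    at most \<open>\<delta> / 2\<close>, hence at most \<mu>. From here on \<delta> is fixed, while
    the bracket penalty is still to be made small.\<close>
  define \<delta> where "\<delta> = min 1 (2 * \<mu>)"
  have \<delta>: "0 < \<delta>" "\<delta> \<le> 1" "\<delta> \<le> 2 * \<mu>" using \<mu> by (auto simp: \<delta>_def)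
  define C where "C = c * (3 * m * (1 / \<delta>) + 1 / 2)"
  have C: "0 \<le> C" using c m \<delta> by (simp add: C_def)
  define \<kappa> where "\<kappa> = \<mu> / (T - t\<^sub>1)"
  have \<kappa>: "0 < \<kappa>" "\<kappa> * (T - t\<^sub>1) = \<mu>" using \<mu> t\<^sub>1 by (auto simp: \<kappa>_def)
  define M where "M = c * (1 + m * L)"
  have M: "0 \<le> M" using c m L by (simp add: M_def)
  \<comment> \<open>Chosen so that the far contribution \<open>M * \<tau>\<close> stays below
    \<open>\<kappa> / 2\<close>; the added 1 covers \<open>M = 0\<close>.\<close>
  define \<tau> where "\<tau> = \<kappa> / (2 * (M + 1))"
  have \<tau>: "0 < \<tau>" using \<kappa> M by (simp add: \<tau>_def)
  have M\<tau>: "M * \<tau> < \<kappa> / 2" using \<kappa> M by (simp add: \<tau>_def field_simps)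
  obtain Wf Wg where W[measurable]: "Wf \<in> borel_measurable borel" "Wg \<in> borel_measurable borel"
    and W0: "\<And>r. 0 \<le> Wf r" "\<And>r. 0 \<le> Wg r"
    and Wfin: "(\<integral>\<^sup>+r\<in>{1..}. ennreal (Wf r / r\<^sup>2) \<partial>lborel) < \<infinity>" "(\<integral>\<^sup>+r\<in>{1..}. ennreal (Wg r / r\<^sup>2) \<partial>lborel) < \<infinity>"
    and Wf: "\<And>t x h r. t\<^sub>1 \<le> t \<Longrightarrow> t \<le> T \<Longrightarrow> 0 < r \<Longrightarrow> norm x \<le> r \<Longrightarrow> norm h \<le> r \<Longrightarrow> \<bar>f t (x + h) - f t x\<bar> \<le> Wf r"
    and Wg: "\<And>t x h r. t\<^sub>1 \<le> t \<Longrightarrow> t \<le> T \<Longrightarrow> 0 < r \<Longrightarrow> norm x \<le> r \<Longrightarrow> norm h \<le> r \<Longrightarrow> \<bar>g t (x + h) - g t x\<bar> \<le> Wg r"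
    using solution_growth_modulus[OF f t\<^sub>1(1), of T] solution_growth_modulus[OF g t\<^sub>1(1), of T] by blast
  define W where "W r = Wf r + Wg r" for r
  have Wm[measurable]: "W \<in> borel_measurable borel" unfolding W_def by measurable
  have "(\<integral>\<^sup>+r\<in>{1..}. ennreal (W r / r\<^sup>2) \<partial>lborel) =
      (\<integral>\<^sup>+r. ennreal (Wf r / r\<^sup>2) * indicator {1..} r + ennreal (Wg r / r\<^sup>2) * indicator {1..} r \<partial>lborel)"
    using W0 by (intro nn_integral_cong) (auto simp: W_def indicator_def add_divide_distrib)
  also have "\<dots> < \<infinity>" using Wfin by (simp add: nn_integral_add)
  finally obtain R where R: "1 \<le> R" "(\<integral>\<^sup>+r\<in>{R<..}. ennreal (W r / r\<^sup>2) \<partial>lborel) \<le> ennreal \<tau>"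
    using nn_integral_tail_small[of "\<lambda>r. ennreal (W r / r\<^sup>2)", OF _ _ \<tau>] by auto
  define E where "E = exp (C * (T - t\<^sub>1))"
  have E: "0 < E" by (simp add: E_def)
  \<comment> \<open>The four bounds secure, in turn: slopes below \<open>L'\<close>, the curvature
    condition of the doubling lemma, at most \<open>\<kappa> / 2\<close> for the local error without
    the bracket, and at most \<open>\<mu> / 2\<close> of penalty at
    \<open>x\<^sub>T\<close>.\<close>
  define \<eta> where "\<eta> = Min {(L' - L) / 3, 1 / \<delta>, \<kappa> / (2 * (C * (2 + R) + 1)), \<mu> / (2 * bracket x\<^sub>T)}"
  have CR: "0 \<le> C * (2 + R)" using C R by simp
  have bx: "0 < bracket x\<^sub>T" using bracket_ge(1)[of x\<^sub>T] by linarith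
  have \<eta>: "0 < \<eta>" using L \<delta> \<kappa> CR \<mu> bx by (simp add: \<eta>_def)
  have "\<eta> \<le> (L' - L) / 3" "\<eta> \<le> 1 / \<delta>" "\<eta> \<le> \<kappa> / (2 * (C * (2 + R) + 1))" "\<eta> \<le> \<mu> / (2 * bracket x\<^sub>T)"
    unfolding \<eta>_def by (rule Min_le, simp, simp)+
  then have \<eta>_le: "L + 3 * \<eta> \<le> L'" "\<eta> \<le> 1 / \<delta>" "\<eta> * (C * (2 + R) + 1) \<le> \<kappa> / 2" "\<eta> * bracket x\<^sub>T \<le> \<mu> / 2"
    using CR bx by (simp_all add: field_simps)
  \<comment> \<open>The solution of \<open>\<beta>' = C * \<beta>\<close> with final value \<eta>:
    its growth absorbs the error \<open>C * \<beta> t * bracket x\<close>, however large the bracket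
    is.\<close>
  define \<beta> where "\<beta> t = \<eta> / E * exp (C * (t - t\<^sub>1))" for t
  have \<beta>_le: "\<beta> t \<le> \<eta>" if "t \<le> T" for t
  proof -
    have "exp (C * (t - t\<^sub>1)) \<le> E" unfolding E_def using C that by (auto intro: mult_left_mono)
    then show ?thesis using \<eta> E by (simp add: \<beta>_def field_simps)
  qed
  have \<beta>_ge: "\<eta> / E \<le> \<beta> t" if "t\<^sub>1 \<le> t" for t
    using mult_left_mono[of 1 "exp (C * (t - t\<^sub>1))" "\<eta> / E"] C that \<eta> E by (simp add: \<beta>_def)
  have \<beta>_deriv: "(\<beta> has_real_derivative C * \<beta> t) (at t)" for t
    unfolding \<beta>_def using E by (auto intro!: derivative_eq_intros)
  define F where "F = (\<lambda>(t, x, z). f t x - g t (x + z) - (norm z)\<^sup>2 / (2 * \<delta>) - \<beta> t * bracket x - \<kappa> * (t - t\<^sub>1))"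
  let ?S = "{t\<^sub>1..T} \<times> (UNIV :: (real ^ 'n) set) \<times> (UNIV :: (real ^ 'n) set)"
  have FT: "5 / 2 * \<mu> \<le> F (T, x\<^sub>T, 0)"
  proof -
    have "\<beta> T * bracket x\<^sub>T \<le> \<eta> * bracket x\<^sub>T" using \<beta>_le[of T] bx by (intro mult_right_mono) auto
    then show ?thesis using \<eta>_le(4) \<mu> \<kappa> by (simp add: F_def)
  qed
  have Ft1: "F (t\<^sub>1, x, z) \<le> 2 * \<mu>" for x z
  proof -
    have "\<bar>g t\<^sub>1 (x + z) - g t\<^sub>1 x\<bar> \<le> L * norm z" by (rule solution_Lipschitz[OF g L(4) t\<^sub>1(1)])
    also have "\<dots> \<le> 1 * norm z" by (intro mult_right_mono L1) auto
    finally have "g t\<^sub>1 x - g t\<^sub>1 (x + z) \<le> norm z" by simp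
    moreover have "norm z - (norm z)\<^sup>2 / (2 * \<delta>) \<le> \<delta> / 2"
    proof -
      have "2 * norm z * \<delta> \<le> (norm z)\<^sup>2 + \<delta>\<^sup>2" by (rule sum_squares_bound)
      then show ?thesis using \<delta> by (simp add: field_simps power2_eq_square)
    qed
    moreover have "0 \<le> \<beta> t\<^sub>1 * bracket x"
      using \<eta> E bracket_ge(1)[of x] by (simp add: \<beta>_def)
    ultimately show ?thesis using init1[of x] \<delta> by (simp add: F_def)
  qed
  have "\<exists>p\<in>?S. \<forall>q\<in>?S. F q \<le> F p"
  proof (rule doubling_coercive[OF f g _ t\<^sub>1(1) _ \<delta>(1,2), where \<epsilon> = "\<eta> / E" and \<beta> = \<beta> and \<kappa> = \<kappa>])
    show "grad_sup_norm g \<le> ereal 1" using L(4) L1 by (metis ereal_less_eq(3) order_trans)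
    show "continuous_on {t\<^sub>1..T} \<beta>" unfolding \<beta>_def by (intro continuous_intros)
    show "(T, x\<^sub>T, 0) \<in> ?S" using t\<^sub>1 by simp
  qed (use t\<^sub>1 \<eta> E \<kappa> \<beta>_ge FT \<mu> in \<open>auto simp: F_def\<close>)
  then obtain P where P: "P \<in> ?S" "\<forall>q\<in>?S. F q \<le> F P" by blast
  obtain t x z where "P = (t, x, z)" by (metis prod_cases3)
  with P have p: "t \<in> {t\<^sub>1..T}" and max: "\<And>q. q \<in> ?S \<Longrightarrow> F q \<le> F (t, x, z)" by auto
  have "5 / 2 * \<mu> \<le> F (t, x, z)" using max[of "(T, x\<^sub>T, 0)"] FT t\<^sub>1 by simp
  then have "t \<noteq> t\<^sub>1" using Ft1[of x z] \<mu> by auto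
  then have t: "t\<^sub>1 < t" "t \<le> T" "0 < t" using p t\<^sub>1 by auto
  define D where "D = deriv (\<lambda>s. f s x) t - deriv (\<lambda>s. g s (x + z)) t"
  have \<beta>t: "0 \<le> \<beta> t" "\<beta> t \<le> \<eta>" using \<beta>_le[OF t(2)] \<eta> E by (auto simp: \<beta>_def)
  \<comment> \<open>The radius is \<open>R + 1\<close> because the speed lemma takes the tail over a
    closed half-line, and \<open>{R + 1..}\<close> lies inside \<open>{R<..}\<close>.\<close>
  have "D \<le> c * (\<beta> t * (3 * m * (1 / \<delta>) + 1 / 2) * (bracket x + 1 + (R + 1)) + (1 + m * L) * \<tau>)"
    unfolding D_def c_def m_def
  proof (rule solution_speed_difference_at_doubling_maximum[OF f g L(1) L1 L(3,4) _ L' t(3) \<delta>(1,2) \<beta>t(1) _ _ Wm])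
    show "L + 3 * \<beta> t \<le> L'" "\<beta> t \<le> 1 / \<delta>" using \<eta>_le \<beta>t by linarith+
    show "f t x' - g t (x' + z') - (norm z')\<^sup>2 / (2 * \<delta>) - \<beta> t * bracket x'
      \<le> f t x - g t (x + z) - (norm z)\<^sup>2 / (2 * \<delta>) - \<beta> t * bracket x" for x' z'
      using max[of "(t, x', z')"] p by (simp add: F_def)
    show "0 \<le> W r" for r using W0 by (simp add: W_def)
    show "\<bar>f t (x + h) - f t x\<bar> + \<bar>g t (y + h) - g t y\<bar> \<le> W r"
      if "0 < r" "norm x \<le> r" "norm y \<le> r" "norm h \<le> r" for x y h r
      unfolding W_def using t that by (intro add_mono Wf Wg) auto
    have "(\<integral>\<^sup>+r\<in>{R + 1..}. ennreal (W r / r\<^sup>2) \<partial>lborel) \<le> (\<integral>\<^sup>+r\<in>{R<..}. ennreal (W r / r\<^sup>2) \<partial>lborel)"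
      by (intro nn_integral_mono) (auto simp: indicator_def)
    with R(2) show "(\<integral>\<^sup>+r\<in>{R + 1..}. ennreal (W r / r\<^sup>2) \<partial>lborel) \<le> ennreal \<tau>" by simp
  qed (use \<tau> R in auto)
  also have "\<dots> = C * \<beta> t * bracket x + \<beta> t * (C * (2 + R)) + M * \<tau>"
  proof -
    have "c * (b * k * (r + 1 + (R + 1)) + j * \<tau>) = c * k * b * r + b * (c * k * (2 + R)) + c * j * \<tau>"
      for b k r j by (simp add: algebra_simps)
    then show ?thesis unfolding C_def M_def .
  qed
  also have "\<dots> < C * \<beta> t * bracket x + \<kappa>"
  proof -
    have "\<beta> t * (C * (2 + R)) \<le> \<eta> * (C * (2 + R) + 1)"
      using \<beta>t CR \<eta> by (intro mult_mono) auto
    then show ?thesis using \<eta>_le(3) M\<tau> by linarith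
  qed
  finally have less: "D < C * \<beta> t * bracket x + \<kappa>" .
  \<comment> \<open>With \<open>x\<close> and \<open>z\<close> frozen, the maximum in time forces
    this derivative to be nonnegative, against the strict bound on \<open>D\<close>.\<close>
  have "((\<lambda>s. f s x - g s (x + z) - (norm z)\<^sup>2 / (2 * \<delta>) - \<beta> s * bracket x - \<kappa> * (s - t\<^sub>1)) has_real_derivative
      D - C * \<beta> t * bracket x - \<kappa>) (at t)"
    unfolding D_def
    by (auto intro!: derivative_eq_intros solution_deriv[OF f t(3)] solution_deriv[OF g t(3)] \<beta>_deriv)
  then have "0 \<le> D - C * \<beta> t * bracket x - \<kappa>"
  proof (rule DERIV_nonneg_at_left_max[OF _ t(1)])
    fix s assume "t\<^sub>1 \<le> s" "s \<le> t"
    then show "f s x - g s (x + z) - (norm z)\<^sup>2 / (2 * \<delta>) - \<beta> s * bracket x - \<kappa> * (s - t\<^sub>1) \<le>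
        f t x - g t (x + z) - (norm z)\<^sup>2 / (2 * \<delta>) - \<beta> t * bracket x - \<kappa> * (t - t\<^sub>1)"
      using max[of "(s, x, z)"] t by (simp add: F_def)
  qed
  with less show False by simp
qed

theorem theorem1p2:
  fixes f g :: "real \<Rightarrow> real ^ 'n \<Rightarrow> real" and d :: nat
  assumes "2 \<le> d" and "CARD('n) = d - 1"
    and "muskat_classical_solution f" and "muskat_classical_solution g"
    and "grad_sup_norm f < ereal (1 / sqrt (2 * real d - 1))"
    and "grad_sup_norm g < ereal (1 / sqrt (2 * real d - 1))"
    and "\<forall>x. f 0 x \<le> g 0 x"
  shows "\<forall>t\<ge>0. \<forall>x. f t x \<le> g t x"
proof (intro allI impI)
  fix t :: real and x :: "real ^ 'n"
  assume "0 \<le> t"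
  \<comment> \<open>The strict hypotheses leave room for a common slope \<open>max a b\<close> below
    \<open>L'\<close>. This gap is what the gradient perturbation by the bracket uses up.\<close>
  define L' where "L' = 1 / sqrt (2 * real d - 1)"
  have d: "real CARD('n) + 1 = real d" using assms(1,2) by simp
  obtain a where a: "grad_sup_norm f < ereal a" "a < L'"
    using ereal_dense2[OF assms(5)] by (auto simp: L'_def)
  obtain b where b: "grad_sup_norm g < ereal b" "b < L'"
    using ereal_dense2[OF assms(6)] by (auto simp: L'_def)
  \<comment> \<open>The gradient at one arbitrary point with positive time shows that the chosen
    slope is nonnegative.\<close>
  have "norm (grad (f 1) 0) \<le> a" using a by (intro solution_grad_le) auto
  then have "0 \<le> max a b" using norm_ge_zero order_trans by (metis max.coboundedI1)
  moreover have "grad_sup_norm f \<le> ereal (max a b)" "grad_sup_norm g \<le> ereal (max a b)"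
    using a b by (auto simp: max_def intro: order_trans less_imp_le)
  moreover have "(2 * (real CARD('n) + 1) - 1) * L'\<^sup>2 \<le> 1"
    unfolding d using assms(1) by (simp add: L'_def power_divide)
  ultimately show "f t x \<le> g t x"
    using muskat_comparison[OF assms(3,4), of "max a b" L' t x] a b assms(7) \<open>0 \<le> t\<close>
    by (cases "t = 0") auto
qed

end
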